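(* Let $I,K\in\mathcal{D}$ be dyadic intervals with $I\subset K$. Then, for every $f\in L^2(\mathbb{R})$ supported in $I$, $$\|\mathbf{1}_K S f\|_{L^2}^2\ge\left(1-\frac34\,\frac{|I|}{|K|}\right)\|f\|_{L^2}^2,$$ where $S$ is the dyadic Hilbert transform (Haar shift).
   Context: $\mathcal{D}=\{[2^k\ell,2^k(\ell+1)) : k,\ell\in\mathbb{Z}\}$ is the set of dyadic intervals of $\mathbb{R}$. For $I\in\mathcal{D}$, $|I|$ is its length and $I_-$, $I_+$ are its left and right halves (dyadic children). The Haar function is $h_I=|I|^{-1/2}(\mathbf{1}_{I_+}-\mathbf{1}_{I_-})$; the family $\{h_I\}_{I\in\mathcal{D}}$ is an orthonormal basis of $L^2(\mathbb{R})$. The dyadic Hilbert transform (Haar shift) $S$ is the bounded linear operator on $L^2(\mathbb{R})$ determined by $S h_I=\frac{1}{\sqrt2}(h_{I_+}-h_{I_-})$ for all $I\in\mathcal{D}$, i.e. $Sf=\sum_{I\in\mathcal{D}}\langle f,h_I\rangle\, S h_I$. It is an isometry of $L^2(\mathbb{R})$. *)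

theory Defs
  imports "HOL-Analysis.Analysis"
begin

definition dyadic_intervals :: "real set set" where
  "dyadic_intervals =
     {{2 powi k * real_of_int l ..< 2 powi k * real_of_int (l + 1)} | k l. True}"

text \<open>The halves are only meant for bounded half-open intervals \<open>I = {a..<b}\<close> with \<open>a < b\<close>,
  where \<open>Inf I = a\<close> and \<open>Sup I = b\<close>.\<close>

definition left_half :: "real set \<Rightarrow> real set" where
  "left_half I = {Inf I ..< (Inf I + Sup I) / 2}"

definition right_half :: "real set \<Rightarrow> real set" where
  "right_half I = {(Inf I + Sup I) / 2 ..< Sup I}"

definition haar :: "real set \<Rightarrow> real \<Rightarrow> real" where
  "haar I x = (indicator (right_half I) x - indicator (left_half I) x) / sqrt (measure lebesgue I)"

text \<open>Elements of \<open>L\<^sup>2(\<real>)\<close> are represented by complex-valued Lebesgue measurable functions;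
  equality in \<open>L\<^sup>2(\<real>)\<close> is equality almost everywhere.\<close>

definition L2 :: "(real \<Rightarrow> complex) set" where
  "L2 = {f \<in> borel_measurable lebesgue. integrable lebesgue (\<lambda>x. (norm (f x))\<^sup>2)}"

definition L2_norm :: "(real \<Rightarrow> complex) \<Rightarrow> real" where
  "L2_norm f = sqrt (LINT x|lebesgue. (norm (f x))\<^sup>2)"

text \<open>The inner product \<open>\<langle>f, h\<^sub>I\<rangle>\<close>; no conjugate is needed since \<open>h\<^sub>I\<close> is real.\<close>

definition haar_coeff :: "(real \<Rightarrow> complex) \<Rightarrow> real set \<Rightarrow> complex" where
  "haar_coeff f I = (LINT x|lebesgue. f x * complex_of_real (haar I x))"

definition shifted_haar :: "real set \<Rightarrow> real \<Rightarrow> real" where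
  "shifted_haar I x = (haar (right_half I) x - haar (left_half I) x) / sqrt 2"

text \<open>\<open>g\<close> is the sum, unconditionally convergent in \<open>L\<^sup>2(\<real>)\<close>, of the series
  \<open>\<Sum>J. \<langle>f, h\<^sub>J\<rangle> S h\<^sub>J\<close> over all dyadic intervals \<open>J\<close>.\<close>

definition is_haar_shift :: "(real \<Rightarrow> complex) \<Rightarrow> (real \<Rightarrow> complex) \<Rightarrow> bool" where
  "is_haar_shift f g \<longleftrightarrow> g \<in> L2 \<and>
     ((\<lambda>F. L2_norm (\<lambda>x. g x - (\<Sum>J\<in>F. haar_coeff f J * complex_of_real (shifted_haar J x))))
        \<longlongrightarrow> 0) (finite_subsets_at_top dyadic_intervals)"

text \<open>The operator \<open>S\<close>. For \<open>f \<in> L2\<close> the sum exists and is unique up to equality almost everywhere;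
  the choice operator merely selects one representative of that class.\<close>

definition haar_shift :: "(real \<Rightarrow> complex) \<Rightarrow> real \<Rightarrow> complex" where
  "haar_shift f = (SOME g. is_haar_shift f g)"

end

theory Submission
  imports Defs
begin

text \<open>
  Write \<open>c\<^sub>J = \<langle>f, h\<^sub>J\<rangle>\<close> and \<open>m = \<integral>f\<close>. The coefficient of \<open>S f\<close> at either child of \<open>J\<close> is \<open>\<plusminus> c\<^sub>J / \<surd>2\<close>,
  so Bessel's inequality for \<open>1\<^sub>K S f\<close> against the Haar functions of the intervals contained
  in \<open>K\<close> bounds its squared norm from below by \<open>\<Sum>\<^sub>J |c\<^sub>J|\<^sup>2 + |c\<^sub>P|\<^sup>2 / 2\<close>, where \<open>J\<close> ranges over the
  dyadic subintervals of \<open>K\<close> and \<open>P\<close> is the parent of \<open>K\<close>. By completeness of the Haar system the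
  sum is \<open>\<parallel>f\<parallel>\<^sup>2 - |m|\<^sup>2 / |K|\<close>, while \<open>|c\<^sub>P|\<^sup>2 = |m|\<^sup>2 / (2 |K|)\<close>; the total is
  \<open>\<parallel>f\<parallel>\<^sup>2 - 3/4 \<sqdot> |m|\<^sup>2 / |K|\<close>, and \<open>|m|\<^sup>2 \<le> |I| \<parallel>f\<parallel>\<^sup>2\<close> by Cauchy--Schwarz.
\<close>

subsection \<open>Square-integrable functions and orthonormal families\<close>

lemma L2_measurable [measurable_dest]: "f \<in> L2 \<Longrightarrow> f \<in> borel_measurable lebesgue"
  by (simp add: L2_def)

lemma L2_integrable_sq: "f \<in> L2 \<Longrightarrow> integrable lebesgue (\<lambda>x. (norm (f x))\<^sup>2)"
  by (simp add: L2_def)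

lemma L2_norm_sq: "(L2_norm f)\<^sup>2 = (LINT x|lebesgue. (norm (f x))\<^sup>2)"
  by (simp add: L2_norm_def)

lemma L2_norm_nonneg: "0 \<le> L2_norm f"
  by (simp add: L2_norm_def)

lemma norm_add_sq_le: "(norm (a + b))\<^sup>2 \<le> 2 * (norm a)\<^sup>2 + 2 * (norm b)\<^sup>2"
  for a b :: "'a::real_normed_vector"
proof -
  have "(norm (a + b))\<^sup>2 \<le> (norm a + norm b)\<^sup>2"
    by (intro power_mono norm_triangle_ineq norm_ge_zero)
  also have "\<dots> \<le> 2 * (norm a)\<^sup>2 + 2 * (norm b)\<^sup>2"
    using sum_squares_bound[of "norm a" "norm b"] by (simp add: power2_sum)
  finally show ?thesis .
qed

lemma L2_bounded:
  assumes "f \<in> borel_measurable lebesgue" "g \<in> L2" "\<And>x. norm (f x) \<le> C * norm (g x)"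
  shows "f \<in> L2"
proof -
  have "integrable lebesgue (\<lambda>x. C\<^sup>2 * (norm (g x))\<^sup>2)"
    using assms(2) by (intro integrable_mult_right L2_integrable_sq)
  then have "integrable lebesgue (\<lambda>x. (norm (f x))\<^sup>2)"
  proof (rule Bochner_Integration.integrable_bound)
    show "(\<lambda>x. (norm (f x))\<^sup>2) \<in> borel_measurable lebesgue"
      using assms(1) by measurable
    show "AE x in lebesgue. norm ((norm (f x))\<^sup>2) \<le> norm (C\<^sup>2 * (norm (g x))\<^sup>2)"
      using power_mono[OF assms(3) norm_ge_zero, where n=2] by (simp add: power_mult_distrib)
  qed
  then show ?thesis using assms(1) by (simp add: L2_def)
qed

lemma L2_cmult: "f \<in> L2 \<Longrightarrow> (\<lambda>x. c * f x) \<in> L2"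
  by (rule L2_bounded[where C="norm c" and g=f]) (auto simp: norm_mult dest: L2_measurable)

lemma L2_indicator: "f \<in> L2 \<Longrightarrow> A \<in> sets lebesgue \<Longrightarrow> (\<lambda>x. indicator A x * f x) \<in> L2"
  by (rule L2_bounded[where C=1 and g=f])
     (auto simp: norm_mult indicator_def dest: L2_measurable)

lemma L2_add:
  assumes "f \<in> L2" "g \<in> L2"
  shows "(\<lambda>x. f x + g x) \<in> L2"
proof -
  note [measurable] = L2_measurable[OF assms(1)] L2_measurable[OF assms(2)]
  have "integrable lebesgue (\<lambda>x. 2 * (norm (f x))\<^sup>2 + 2 * (norm (g x))\<^sup>2)"
    using assms by (intro Bochner_Integration.integrable_add integrable_mult_right L2_integrable_sq)
  then have "integrable lebesgue (\<lambda>x. (norm (f x + g x))\<^sup>2)"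
    by (rule Bochner_Integration.integrable_bound) (auto intro!: norm_add_sq_le)
  then show ?thesis by (simp add: L2_def)
qed

lemma L2_diff: "f \<in> L2 \<Longrightarrow> g \<in> L2 \<Longrightarrow> (\<lambda>x. f x - g x) \<in> L2"
  using L2_add[of f "\<lambda>x. (-1) * g x"] L2_cmult[of g "-1"] by simp

lemma L2_zero: "(\<lambda>x. 0) \<in> L2"
  by (simp add: L2_def)

lemma L2_sum: "(\<And>i. i \<in> F \<Longrightarrow> f i \<in> L2) \<Longrightarrow> (\<lambda>x. \<Sum>i\<in>F. f i x) \<in> L2"
  by (induction F rule: infinite_finite_induct) (auto intro: L2_zero L2_add)

lemma L2_integrable_mult:
  assumes "f \<in> L2" "g \<in> L2"
  shows "integrable lebesgue (\<lambda>x. f x * g x)"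
proof -
  note [measurable] = L2_measurable[OF assms(1)] L2_measurable[OF assms(2)]
  have "integrable lebesgue (\<lambda>x. (norm (f x))\<^sup>2 + (norm (g x))\<^sup>2)"
    using assms by (intro Bochner_Integration.integrable_add L2_integrable_sq)
  then show ?thesis
  proof (rule Bochner_Integration.integrable_bound)
    show "AE x in lebesgue. norm (f x * g x) \<le> norm ((norm (f x))\<^sup>2 + (norm (g x))\<^sup>2)"
    proof (intro AE_I2)
      fix x
      have "0 \<le> norm (f x) * norm (g x)" by simp
      then have "norm (f x) * norm (g x) \<le> (norm (f x))\<^sup>2 + (norm (g x))\<^sup>2"
        using sum_squares_bound[of "norm (f x)" "norm (g x)"] by linarith
      then show "norm (f x * g x) \<le> norm ((norm (f x))\<^sup>2 + (norm (g x))\<^sup>2)"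
        by (simp add: norm_mult)
    qed
  qed measurable
qed

lemma L2_cnj: "f \<in> L2 \<Longrightarrow> (\<lambda>x. cnj (f x)) \<in> L2"
  by (rule L2_bounded[where C=1 and g=f])
     (auto dest!: L2_measurable intro!: borel_measurable_continuous_onI continuous_intros
       intro: measurable_compose[of f _ _ cnj])

lemma L2_norm_add_sq_le:
  assumes "f \<in> L2" "g \<in> L2"
  shows "(L2_norm (\<lambda>x. f x + g x))\<^sup>2 \<le> 2 * (L2_norm f)\<^sup>2 + 2 * (L2_norm g)\<^sup>2"
proof -
  have "(LINT x|lebesgue. (norm (f x + g x))\<^sup>2)
      \<le> (LINT x|lebesgue. 2 * (norm (f x))\<^sup>2 + 2 * (norm (g x))\<^sup>2)"
    using assms
    by (intro integral_mono L2_integrable_sq L2_add norm_add_sq_le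
        Bochner_Integration.integrable_add integrable_mult_right)
  also have "\<dots> = 2 * (L2_norm f)\<^sup>2 + 2 * (L2_norm g)\<^sup>2"
    using assms by (simp add: L2_norm_sq L2_integrable_sq)
  finally show ?thesis by (simp add: L2_norm_sq)
qed

lemma L2_norm_diff_sq:
  assumes "f \<in> L2" "g \<in> L2"
  shows "(L2_norm (\<lambda>x. f x - g x))\<^sup>2
       = (L2_norm f)\<^sup>2 + (L2_norm g)\<^sup>2 - 2 * Re (LINT x|lebesgue. f x * cnj (g x))"
proof -
  have *: "(norm (f x - g x))\<^sup>2 = (norm (f x))\<^sup>2 + (norm (g x))\<^sup>2 - 2 * Re (f x * cnj (g x))" for x
    by (simp only: cmod_power2) (simp add: power2_eq_square algebra_simps)
  have i: "integrable lebesgue (\<lambda>x. f x * cnj (g x))"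
    by (intro L2_integrable_mult L2_cnj assms)
  have r: "integrable lebesgue (\<lambda>x. 2 * Re (f x * cnj (g x)))"
    using i by (intro integrable_mult_right integrable_Re)
  have "(LINT x|lebesgue. 2 * Re (f x * cnj (g x))) = 2 * Re (LINT x|lebesgue. f x * cnj (g x))"
    by (simp only: integral_mult_right_zero integral_Re[OF i])
  then show ?thesis
    unfolding L2_norm_sq * using assms r
    by (simp only: Bochner_Integration.integral_diff Bochner_Integration.integral_add
        L2_integrable_sq Bochner_Integration.integrable_add)
qed

section \<open>Coefficients against orthonormal families, up to Bessel's inequality\<close>

text \<open>Stated for an arbitrary real-valued \<open>e\<close>, so that the same lemmas serve both
  \<open>haar\<close> and \<open>shifted_haar\<close>; with \<open>e\<close> real, no conjugate
  appears.\<close>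

definition L2_coeff :: "(real \<Rightarrow> complex) \<Rightarrow> (real \<Rightarrow> real) \<Rightarrow> complex" where
  "L2_coeff f e = (LINT x|lebesgue. f x * complex_of_real (e x))"

definition orthonormal_on :: "'i set \<Rightarrow> ('i \<Rightarrow> real \<Rightarrow> real) \<Rightarrow> bool" where
  "orthonormal_on A e \<longleftrightarrow> (\<forall>i\<in>A. (\<lambda>x. complex_of_real (e i x)) \<in> L2) \<and>
     (\<forall>i\<in>A. \<forall>j\<in>A. (LINT x|lebesgue. e i x * e j x) = (if i = j then 1 else 0))"

lemma orthonormal_onD:
  assumes "orthonormal_on A e"
  shows "i \<in> A \<Longrightarrow> (\<lambda>x. complex_of_real (e i x)) \<in> L2"
    and "i \<in> A \<Longrightarrow> j \<in> A \<Longrightarrow> L2_coeff (\<lambda>x. complex_of_real (e i x)) (e j) = (if i = j then 1 else 0)"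
proof -
  show "i \<in> A \<Longrightarrow> (\<lambda>x. complex_of_real (e i x)) \<in> L2"
    using assms by (simp add: orthonormal_on_def)
  assume "i \<in> A" "j \<in> A"
  then have "(LINT x|lebesgue. e i x * e j x) = (if i = j then 1 else 0)"
    using assms by (simp add: orthonormal_on_def)
  then show "L2_coeff (\<lambda>x. complex_of_real (e i x)) (e j) = (if i = j then 1 else 0)"
    unfolding L2_coeff_def of_real_mult[symmetric] integral_complex_of_real by simp
qed

lemma L2_sum_orthonormal:
  assumes "orthonormal_on A e" "F \<subseteq> A"
  shows "(\<lambda>x. \<Sum>i\<in>F. c i * complex_of_real (e i x)) \<in> L2"
  using assms by (intro L2_sum L2_cmult) (auto intro: orthonormal_onD(1))

lemma L2_coeff_sum:
  assumes "\<And>i. i \<in> F \<Longrightarrow> f i \<in> L2" "(\<lambda>x. complex_of_real (e x)) \<in> L2"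
  shows "L2_coeff (\<lambda>x. \<Sum>i\<in>F. c i * f i x) e = (\<Sum>i\<in>F. c i * L2_coeff (f i) e)"
proof -
  have "integrable lebesgue (\<lambda>x. c i * (f i x * complex_of_real (e x)))" if "i \<in> F" for i
    using that assms by (intro integrable_mult_right L2_integrable_mult)
  then show ?thesis
    by (simp add: L2_coeff_def sum_distrib_right mult.assoc)
qed

lemma L2_coeff_diff:
  assumes "f \<in> L2" "g \<in> L2" "(\<lambda>x. complex_of_real (e x)) \<in> L2"
  shows "L2_coeff (\<lambda>x. f x - g x) e = L2_coeff f e - L2_coeff g e"
  using L2_integrable_mult[OF assms(1,3)] L2_integrable_mult[OF assms(2,3)]
  by (simp add: L2_coeff_def left_diff_distrib)

lemma inner_orthonormal_sum:
  assumes "orthonormal_on A e" "F \<subseteq> A" "f \<in> L2"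
  shows "(LINT x|lebesgue. f x * cnj (\<Sum>i\<in>F. c i * complex_of_real (e i x)))
       = (\<Sum>i\<in>F. cnj (c i) * L2_coeff f (e i))"
proof -
  have "integrable lebesgue (\<lambda>x. cnj (c i) * (f x * complex_of_real (e i x)))" if "i \<in> F" for i
    using that assms by (intro integrable_mult_right L2_integrable_mult) (auto intro: orthonormal_onD(1))
  then have "(LINT x|lebesgue. (\<Sum>i\<in>F. cnj (c i) * (f x * complex_of_real (e i x))))
      = (\<Sum>i\<in>F. cnj (c i) * L2_coeff f (e i))"
    by (subst Bochner_Integration.integral_sum) (simp_all add: L2_coeff_def)
  then show ?thesis
    by (simp add: sum_distrib_left mult.left_commute)
qed

lemma L2_coeff_orthonormal_sum:
  assumes "orthonormal_on A e" "finite F" "F \<subseteq> A" "j \<in> A"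
  shows "L2_coeff (\<lambda>x. \<Sum>i\<in>F. c i * complex_of_real (e i x)) (e j) = (if j \<in> F then c j else 0)"
proof -
  have "L2_coeff (\<lambda>x. \<Sum>i\<in>F. c i * complex_of_real (e i x)) (e j)
     = (\<Sum>i\<in>F. c i * L2_coeff (\<lambda>x. complex_of_real (e i x)) (e j))"
    using assms by (intro L2_coeff_sum orthonormal_onD(1)[OF assms(1)]) auto
  also have "\<dots> = (\<Sum>i\<in>F. if j = i then c i else 0)"
    using assms by (intro sum.cong) (auto simp: orthonormal_onD(2)[OF assms(1)])
  finally show ?thesis using assms by simp
qed

lemma L2_norm_orthonormal_sum:
  assumes "orthonormal_on A e" "finite F" "F \<subseteq> A"
  shows "(L2_norm (\<lambda>x. \<Sum>i\<in>F. c i * complex_of_real (e i x)))\<^sup>2 = (\<Sum>i\<in>F. (norm (c i))\<^sup>2)"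
proof -
  let ?s = "\<lambda>x. \<Sum>i\<in>F. c i * complex_of_real (e i x)"
  have "complex_of_real ((L2_norm ?s)\<^sup>2) = (LINT x|lebesgue. ?s x * cnj (?s x))"
    by (simp only: L2_norm_sq complex_norm_square flip: integral_complex_of_real)
  also have "\<dots> = (\<Sum>i\<in>F. cnj (c i) * L2_coeff ?s (e i))"
    using assms by (intro inner_orthonormal_sum L2_sum_orthonormal) auto
  also have "\<dots> = (\<Sum>i\<in>F. cnj (c i) * c i)"
    using assms by (intro sum.cong) (auto simp: L2_coeff_orthonormal_sum[OF assms(1-3)])
  also have "\<dots> = complex_of_real (\<Sum>i\<in>F. (norm (c i))\<^sup>2)"
    by (simp only: of_real_sum complex_norm_square mult.commute)
  finally show ?thesis by (simp only: of_real_eq_iff)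
qed

text \<open>Expand \<open>0 \<le> \<parallel>f - s\<parallel>\<^sup>2\<close> with \<open>s\<close>
  the projection of \<open>f\<close> onto the span of the family: the inner product of
  \<open>f\<close> and \<open>s\<close> and the squared norm of \<open>s\<close> are the same
  sum.\<close>

lemma bessel_finite:
  assumes "orthonormal_on A e" "finite F" "F \<subseteq> A" "f \<in> L2"
  shows "(\<Sum>i\<in>F. (norm (L2_coeff f (e i)))\<^sup>2) \<le> (L2_norm f)\<^sup>2"
proof -
  let ?c = "\<lambda>i. L2_coeff f (e i)"
  let ?s = "\<lambda>x. \<Sum>i\<in>F. ?c i * complex_of_real (e i x)"
  have "0 \<le> (L2_norm (\<lambda>x. f x - ?s x))\<^sup>2" by simp
  also have "\<dots> = (L2_norm f)\<^sup>2 + (L2_norm ?s)\<^sup>2 - 2 * Re (LINT x|lebesgue. f x * cnj (?s x))"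
    using assms by (intro L2_norm_diff_sq L2_sum_orthonormal)
  also have "(LINT x|lebesgue. f x * cnj (?s x)) = (\<Sum>i\<in>F. cnj (?c i) * ?c i)"
    using assms by (intro inner_orthonormal_sum)
  also have "\<dots> = complex_of_real (\<Sum>i\<in>F. (norm (?c i))\<^sup>2)"
    by (simp only: of_real_sum complex_norm_square mult.commute)
  also have "(L2_norm ?s)\<^sup>2 = (\<Sum>i\<in>F. (norm (?c i))\<^sup>2)"
    using assms by (intro L2_norm_orthonormal_sum)
  finally show ?thesis by (simp del: of_real_sum)
qed

subsection \<open>The Riesz--Fischer theorem\<close>

lemma nn_integral_norm_sq: "f \<in> L2 \<Longrightarrow>
  (\<integral>\<^sup>+x. ennreal ((norm (f x))\<^sup>2) \<partial>lebesgue) = ennreal ((L2_norm f)\<^sup>2)"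
  by (simp add: L2_norm_sq nn_integral_eq_integral L2_integrable_sq)

text \<open>Meant for limit functions that are not yet known to be integrable: a bound on the
  nonnegative integral gives membership and norm bound at once.\<close>

lemma L2_nn_boundI:
  assumes "f \<in> borel_measurable lebesgue" "0 \<le> C"
    and "(\<integral>\<^sup>+x. ennreal ((norm (f x))\<^sup>2) \<partial>lebesgue) \<le> ennreal C"
  shows "f \<in> L2" "(L2_norm f)\<^sup>2 \<le> C"
proof -
  have "(\<integral>\<^sup>+x. ennreal (norm ((norm (f x))\<^sup>2)) \<partial>lebesgue) < \<infinity>"
    using assms(3) by (simp add: order.strict_trans1)
  then show L: "f \<in> L2"
    using assms(1) unfolding L2_def integrable_iff_bounded by simp
  show "(L2_norm f)\<^sup>2 \<le> C"
    using assms nn_integral_norm_sq[OF L] by simp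
qed

text \<open>The terms of a convergent series are bounded, so the weight \<open>4 ^ n\<close> forces
  the increments below a multiple of \<open>(1/2) ^ n\<close>; the telescoping series then converges
  absolutely.\<close>

lemma convergent_if_weighted_sum_finite:
  fixes s :: "nat \<Rightarrow> complex"
  assumes "(\<Sum>n. ennreal (4 ^ n * (norm (s (Suc n) - s n))\<^sup>2)) < \<infinity>"
  shows "convergent s"
proof -
  have sm: "summable (\<lambda>n. 4 ^ n * (norm (s (Suc n) - s n))\<^sup>2)"
    using assms by (intro summable_suminf_not_top) auto
  then have "Bseq (\<lambda>n. 4 ^ n * (norm (s (Suc n) - s n))\<^sup>2)"
    by (intro convergent_imp_Bseq convergentI[OF summable_LIMSEQ_zero])
  then obtain C where C: "C > 0" "\<And>n. norm (4 ^ n * (norm (s (Suc n) - s n))\<^sup>2) \<le> C"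
    by (auto simp: Bseq_def)
  have "norm (s (Suc n) - s n) \<le> sqrt C * (1/2) ^ n" for n
  proof -
    have "(2 ^ n * norm (s (Suc n) - s n))\<^sup>2 \<le> C"
    proof -
      have "(4::real) ^ n = (2 ^ n)\<^sup>2"
        by (simp only: power2_eq_square power_mult_distrib[symmetric]) simp
      then show ?thesis using C(2)[of n] by (simp only: power_mult_distrib) simp
    qed
    then have "2 ^ n * norm (s (Suc n) - s n) \<le> sqrt C"
      by (rule real_le_rsqrt)
    then have "2 ^ n * norm (s (Suc n) - s n) * (1/2) ^ n \<le> sqrt C * (1/2) ^ n"
      by (rule mult_right_mono) simp
    then show ?thesis by (simp add: power_one_over)
  qed
  moreover have "summable (\<lambda>n. sqrt C * (1/2) ^ n)"
    by (intro summable_mult summable_geometric) simp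
  ultimately have "summable (\<lambda>n. s (Suc n) - s n)"
    by (rule summable_comparison_test'[where N=0, rotated])
  then have "convergent (\<lambda>n. \<Sum>i<n. s (Suc i) - s i)"
    by (simp add: summable_iff_convergent)
  then have "convergent (\<lambda>n. s n - s 0)"
    by (simp only: sum_lessThan_telescope)
  from convergent_add[OF this convergent_const[of "s 0"]] show ?thesis by simp
qed

text \<open>The rate 1/8 leaves room for the weight 4 of the preceding lemma: the integrals of the
  weighted squared increments are at most \<open>(1/2) ^ n\<close>. Hence the weighted series is
  finite almost everywhere, \<open>s\<close> converges there, and Fatou's lemma carries the distance
  estimate to the limit.\<close>

lemma L2_fast_cauchy_converges:
  fixes s :: "nat \<Rightarrow> real \<Rightarrow> complex"
  assumes s: "\<And>n. s n \<in> L2"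
    and d: "\<And>m n. n \<le> m \<Longrightarrow> (L2_norm (\<lambda>x. s m x - s n x))\<^sup>2 \<le> (1/8) ^ n"
  obtains g where "g \<in> L2" "\<And>n. (L2_norm (\<lambda>x. g x - s n x))\<^sup>2 \<le> (1/8) ^ n"
proof -
  note [measurable] = L2_measurable[OF s]
  \<comment> \<open>Taking \<open>lim\<close> at every point makes \<open>g\<close> measurable
    outright; its unspecified values where \<open>s\<close> diverges sit on a null set.\<close>
  define g where "g x = lim (\<lambda>n. s n x)" for x
  have g [measurable]: "g \<in> borel_measurable lebesgue"
    unfolding g_def by measurable
  have "(\<integral>\<^sup>+x. (\<Sum>n. ennreal (4 ^ n * (norm (s (Suc n) x - s n x))\<^sup>2)) \<partial>lebesgue)
      = (\<Sum>n. \<integral>\<^sup>+x. ennreal (4 ^ n * (norm (s (Suc n) x - s n x))\<^sup>2) \<partial>lebesgue)"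
    by (rule nn_integral_suminf) measurable
  also have "\<dots> \<le> (\<Sum>n. ennreal ((1/2) ^ n))"
  proof (intro suminf_le allI)
    fix n
    have "(\<integral>\<^sup>+x. ennreal (4 ^ n * (norm (s (Suc n) x - s n x))\<^sup>2) \<partial>lebesgue)
        = ennreal (4 ^ n) * ennreal ((L2_norm (\<lambda>x. s (Suc n) x - s n x))\<^sup>2)"
      using s by (simp add: ennreal_mult' nn_integral_cmult nn_integral_norm_sq L2_diff)
    also have "\<dots> \<le> ennreal (4 ^ n) * ennreal ((1/8) ^ n)"
      by (intro mult_left_mono ennreal_leI d) auto
    also have "\<dots> = ennreal (4 ^ n * (1/8) ^ n)"
      by (rule ennreal_mult'[symmetric]) simp
    also have "(4::real) ^ n * (1/8) ^ n = (1/2) ^ n"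
      by (subst power_mult_distrib[symmetric]) simp
    finally show "(\<integral>\<^sup>+x. ennreal (4 ^ n * (norm (s (Suc n) x - s n x))\<^sup>2) \<partial>lebesgue) \<le> ennreal ((1/2) ^ n)" .
  qed auto
  also have "\<dots> < \<infinity>"
    by (subst suminf_ennreal2) (auto simp: summable_geometric)
  finally have "AE x in lebesgue. (\<Sum>n. ennreal (4 ^ n * (norm (s (Suc n) x - s n x))\<^sup>2)) \<noteq> \<infinity>"
    by (intro nn_integral_PInf_AE) (auto simp: less_top)
  then have lim: "AE x in lebesgue. (\<lambda>n. s n x) \<longlonglongrightarrow> g x"
  proof eventually_elim
    case (elim x)
    then have "convergent (\<lambda>n. s n x)"
      by (intro convergent_if_weighted_sum_finite) (simp add: less_top)
    then show ?case by (simp add: g_def convergent_LIMSEQ_iff)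
  qed
  have bound: "(\<integral>\<^sup>+x. ennreal ((norm (g x - s n x))\<^sup>2) \<partial>lebesgue) \<le> ennreal ((1/8) ^ n)" for n
  proof -
    have "(\<integral>\<^sup>+x. ennreal ((norm (g x - s n x))\<^sup>2) \<partial>lebesgue)
        = (\<integral>\<^sup>+x. liminf (\<lambda>m. ennreal ((norm (s m x - s n x))\<^sup>2)) \<partial>lebesgue)"
    proof (rule nn_integral_cong_AE, use lim in eventually_elim)
      case (elim x)
      then have "(\<lambda>m. ennreal ((norm (s m x - s n x))\<^sup>2)) \<longlonglongrightarrow> ennreal ((norm (g x - s n x))\<^sup>2)"
        by (intro tendsto_intros)
      from lim_imp_Liminf[OF _ this] show ?case by simp
    qed
    also have "\<dots> \<le> liminf (\<lambda>m. \<integral>\<^sup>+x. ennreal ((norm (s m x - s n x))\<^sup>2) \<partial>lebesgue)"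
      by (rule nn_integral_liminf) measurable
    also have "\<dots> = liminf (\<lambda>m. ennreal ((L2_norm (\<lambda>x. s m x - s n x))\<^sup>2))"
      by (simp add: nn_integral_norm_sq L2_diff s)
    also have "\<dots> \<le> liminf (\<lambda>m. ennreal ((1/8) ^ n))"
      by (rule Liminf_mono) (auto intro!: eventually_sequentiallyI[of n] ennreal_leI d)
    finally show ?thesis by (simp add: Liminf_const)
  qed
  have m: "(\<lambda>x. g x - s n x) \<in> borel_measurable lebesgue" for n
    by measurable
  have n: "(L2_norm (\<lambda>x. g x - s n x))\<^sup>2 \<le> (1/8) ^ n" for n
    by (rule L2_nn_boundI(2)[OF m _ bound]) simp
  \<comment> \<open>Fatou only controls differences, so \<open>g\<close> is recovered by adding
    \<open>s 0\<close> back.\<close>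
  have "(\<lambda>x. g x - s 0 x) \<in> L2"
    by (rule L2_nn_boundI(1)[OF m _ bound]) simp
  from L2_add[OF this s[of 0]] have "g \<in> L2" by simp
  then show ?thesis using n by (rule that)
qed

text \<open>Take \<open>F\<close> with sum within \<open>e\<close> of the supremum of all finite
  sums; a finite set disjoint from \<open>F\<close> with sum above \<open>e\<close> would push the
  union past that supremum.\<close>

lemma finite_tail_small:
  fixes a :: "'i \<Rightarrow> real"
  assumes "\<And>F. finite F \<Longrightarrow> F \<subseteq> A \<Longrightarrow> (\<Sum>i\<in>F. a i) \<le> B" "\<And>i. i \<in> A \<Longrightarrow> 0 \<le> a i" "0 < e"
  obtains F where "finite F" "F \<subseteq> A"
    "\<And>G. finite G \<Longrightarrow> G \<subseteq> A \<Longrightarrow> G \<inter> F = {} \<Longrightarrow> (\<Sum>i\<in>G. a i) \<le> e"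
proof -
  let ?X = "{(\<Sum>i\<in>F. a i) |F. finite F \<and> F \<subseteq> A}"
  have ne: "?X \<noteq> {}" by blast
  have bdd: "bdd_above ?X" using assms(1) by (intro bdd_aboveI[of _ B]) auto
  have "Sup ?X - e < Sup ?X" using assms(3) by simp
  then obtain F where F: "finite F" "F \<subseteq> A" "Sup ?X - e < (\<Sum>i\<in>F. a i)"
    using less_cSup_iff[OF ne bdd] by auto
  show ?thesis
  proof (rule that[OF F(1,2)])
    fix G assume G: "finite G" "G \<subseteq> A" "G \<inter> F = {}"
    have "(\<Sum>i\<in>G \<union> F. a i) \<in> ?X"
      using F G by blast
    then have "(\<Sum>i\<in>G \<union> F. a i) \<le> Sup ?X" using bdd by (rule cSup_upper)
    then show "(\<Sum>i\<in>G. a i) \<le> e"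
      using F G by (simp add: sum.union_disjoint)
  qed
qed

text \<open>The net of finite partial sums is first tamed by a sequence of finite sets whose tails
  are at most \<open>(1/8) ^ n\<close>. The limit \<open>g\<close> along that sequence is then
  compared with the partial sum over any larger finite set.\<close>

theorem riesz_fischer:
  assumes e: "orthonormal_on A e"
    and B: "\<And>F. finite F \<Longrightarrow> F \<subseteq> A \<Longrightarrow> (\<Sum>i\<in>F. (norm (c i))\<^sup>2) \<le> B"
  obtains g where "g \<in> L2"
    "((\<lambda>F. L2_norm (\<lambda>x. g x - (\<Sum>i\<in>F. c i * complex_of_real (e i x)))) \<longlongrightarrow> 0) (finite_subsets_at_top A)"
proof -
  define S where "S F x = (\<Sum>i\<in>F. c i * complex_of_real (e i x))" for F x
  have S: "S F \<in> L2" if "F \<subseteq> A" for F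
    unfolding S_def[abs_def] using e that by (rule L2_sum_orthonormal)
  have SD: "(L2_norm (\<lambda>x. S G x - S F x))\<^sup>2 = (\<Sum>i\<in>G - F. (norm (c i))\<^sup>2)"
    if "finite G" "F \<subseteq> G" "G \<subseteq> A" for F G
  proof -
    have "S G x - S F x = (\<Sum>i\<in>G - F. c i * complex_of_real (e i x))" for x
      unfolding S_def using that by (simp add: sum_diff)
    then show ?thesis using that by (auto intro!: L2_norm_orthonormal_sum[OF e])
  qed
  have "\<exists>F. finite F \<and> F \<subseteq> A \<and> (\<forall>G. finite G \<and> G \<subseteq> A \<and> G \<inter> F = {} \<longrightarrow> (\<Sum>i\<in>G. (norm (c i))\<^sup>2) \<le> (1/8) ^ n)"
    for n :: nat
  proof -
    obtain F where "finite F" "F \<subseteq> A"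
      "\<And>G. finite G \<Longrightarrow> G \<subseteq> A \<Longrightarrow> G \<inter> F = {} \<Longrightarrow> (\<Sum>i\<in>G. (norm (c i))\<^sup>2) \<le> (1/8) ^ n"
      by (rule finite_tail_small[of A "\<lambda>i. (norm (c i))\<^sup>2" B "(1/8) ^ n"]) (simp_all add: B)
    then show ?thesis by (intro exI[of _ F]) simp
  qed
  then have "\<exists>F0. \<forall>n. finite (F0 n) \<and> F0 n \<subseteq> A \<and>
      (\<forall>G. finite G \<and> G \<subseteq> A \<and> G \<inter> F0 n = {} \<longrightarrow> (\<Sum>i\<in>G. (norm (c i))\<^sup>2) \<le> (1/8) ^ n)"
    by (intro choice allI)
  then obtain F0 where "\<forall>n. finite (F0 n) \<and> F0 n \<subseteq> A \<and>
      (\<forall>G. finite G \<and> G \<subseteq> A \<and> G \<inter> F0 n = {} \<longrightarrow> (\<Sum>i\<in>G. (norm (c i))\<^sup>2) \<le> (1/8) ^ n)" ..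
  then have F0: "\<And>n. finite (F0 n)" "\<And>n. F0 n \<subseteq> A"
    "\<And>n G. finite G \<Longrightarrow> G \<subseteq> A \<Longrightarrow> G \<inter> F0 n = {} \<Longrightarrow> (\<Sum>i\<in>G. (norm (c i))\<^sup>2) \<le> (1/8) ^ n"
    by simp_all
  \<comment> \<open>The unions make the sets increasing and keep the tail estimate, since a set
    avoiding \<open>F n\<close> also avoids \<open>F0 n\<close>.\<close>
  define F where "F n = (\<Union>k\<le>n. F0 k)" for n
  have F: "finite (F n)" "F n \<subseteq> A" "F0 n \<subseteq> F n" for n
    using F0(1,2) by (auto simp: F_def)
  have F_mono: "F n \<subseteq> F m" if "n \<le> m" for n m
    using that by (force simp: F_def)
  have near: "(L2_norm (\<lambda>x. S G x - S (F n) x))\<^sup>2 \<le> (1/8) ^ n"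
    if "finite G" "G \<subseteq> A" "F n \<subseteq> G" for G n
  proof -
    have "(\<Sum>i\<in>G - F n. (norm (c i))\<^sup>2) \<le> (1/8) ^ n"
      using that F(3)[of n] by (intro F0(3)) auto
    then show ?thesis using SD[of G "F n"] that by simp
  qed
  obtain g where g: "g \<in> L2" "\<And>n. (L2_norm (\<lambda>x. g x - S (F n) x))\<^sup>2 \<le> (1/8) ^ n"
  proof (rule L2_fast_cauchy_converges[of "\<lambda>n. S (F n)"])
    show "S (F n) \<in> L2" for n
      by (intro S F)
    show "(L2_norm (\<lambda>x. S (F m) x - S (F n) x))\<^sup>2 \<le> (1/8) ^ n" if "n \<le> m" for m n
      by (intro near F F_mono that)
  qed blast
  have bound: "(L2_norm (\<lambda>x. g x - S G x))\<^sup>2 \<le> 4 * (1/8) ^ n"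
    if G: "finite G" "G \<subseteq> A" "F n \<subseteq> G" for G n
  proof -
    \<comment> \<open>\<open>g - S G\<close> is split at \<open>S (F n)\<close>; both pieces have
      squared norm at most \<open>(1/8) ^ n\<close>, and the estimate for a sum doubles each, whence
      the factor 4.\<close>
    let ?u = "\<lambda>x. g x - S (F n) x" and ?v = "\<lambda>x. (-1) * (S G x - S (F n) x)"
    have "(L2_norm (\<lambda>x. ?u x + ?v x))\<^sup>2 \<le> 2 * (L2_norm ?u)\<^sup>2 + 2 * (L2_norm ?v)\<^sup>2"
      using G F g(1) S by (intro L2_norm_add_sq_le L2_cmult L2_diff) auto
    moreover have "L2_norm ?v = L2_norm (\<lambda>x. S G x - S (F n) x)"
      unfolding L2_norm_def norm_mult by simp
    ultimately show ?thesis
      using g(2)[of n] near[OF G] by simp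
  qed
  have "((\<lambda>G. L2_norm (\<lambda>x. g x - S G x)) \<longlongrightarrow> 0) (finite_subsets_at_top A)"
  proof (rule tendstoI)
    fix \<epsilon> :: real assume "0 < \<epsilon>"
    then have "0 < \<epsilon>\<^sup>2 / 4" by simp
    then obtain n where n: "(1/8::real) ^ n < \<epsilon>\<^sup>2 / 4"
      using real_arch_pow_inv[of "\<epsilon>\<^sup>2 / 4" "1/8"] by auto
    have "L2_norm (\<lambda>x. g x - S G x) < \<epsilon>" if "finite G" "G \<subseteq> A" "F n \<subseteq> G" for G
    proof -
      have "(L2_norm (\<lambda>x. g x - S G x))\<^sup>2 < \<epsilon>\<^sup>2"
        using bound[OF that] n by simp
      then show ?thesis using \<open>0 < \<epsilon>\<close> by (simp add: power_less_imp_less_base)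
    qed
    then have "\<forall>\<^sub>F G in finite_subsets_at_top A. L2_norm (\<lambda>x. g x - S G x) < \<epsilon>"
      unfolding eventually_finite_subsets_at_top using F(1,2)[of n] by (intro exI[of _ "F n"]) auto
    then show "\<forall>\<^sub>F G in finite_subsets_at_top A. dist (L2_norm (\<lambda>x. g x - S G x)) 0 < \<epsilon>"
      by (simp add: L2_norm_nonneg)
  qed
  then show ?thesis
    unfolding S_def by (rule that[OF g(1)])
qed

text \<open>A single coefficient is continuous in the norm: Bessel's inequality for the one-element
  family \<open>{j}\<close>, applied to \<open>g - u F\<close>.\<close>

lemma L2_coeff_limit:
  assumes e: "orthonormal_on A e" and g: "g \<in> L2" and u: "\<And>F. F \<subseteq> A' \<Longrightarrow> u F \<in> L2"
    and lim: "((\<lambda>F. L2_norm (\<lambda>x. g x - u F x)) \<longlongrightarrow> 0) (finite_subsets_at_top A')"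
    and j: "j \<in> A"
  shows "((\<lambda>F. L2_coeff (u F) (e j)) \<longlongrightarrow> L2_coeff g (e j)) (finite_subsets_at_top A')"
proof -
  have "norm (L2_coeff g (e j) - L2_coeff (u F) (e j)) \<le> L2_norm (\<lambda>x. g x - u F x)"
    if "F \<subseteq> A'" for F
  proof -
    have "(norm (L2_coeff g (e j) - L2_coeff (u F) (e j)))\<^sup>2 \<le> (L2_norm (\<lambda>x. g x - u F x))\<^sup>2"
      using bessel_finite[OF e, of "{j}" "\<lambda>x. g x - u F x"] u[OF that] g j
      by (simp add: L2_diff L2_coeff_diff orthonormal_onD(1)[OF e])
    then show ?thesis using L2_norm_nonneg by (rule power2_le_imp_le)
  qed
  then have "\<forall>\<^sub>F F in finite_subsets_at_top A'.
      norm (L2_coeff g (e j) - L2_coeff (u F) (e j)) \<le> L2_norm (\<lambda>x. g x - u F x)"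
    by (intro eventually_finite_subsets_at_top_weakI)
  then have "((\<lambda>F. L2_coeff g (e j) - L2_coeff (u F) (e j)) \<longlongrightarrow> 0) (finite_subsets_at_top A')"
    using lim by (rule Lim_null_comparison)
  from tendsto_diff[OF tendsto_const[of "L2_coeff g (e j)"] this] show ?thesis
    by simp
qed

subsection \<open>Dyadic intervals and the Haar system\<close>

text \<open>Indexing by scale \<open>k\<close> and position \<open>l\<close> turns passing to halves
  into arithmetic on the indices.\<close>

definition dyad :: "int \<Rightarrow> int \<Rightarrow> real set" where
  "dyad k l = {2 powi k * real_of_int l ..< 2 powi k * real_of_int (l + 1)}"

lemma dyadic_intervals_eq: "dyadic_intervals = {dyad k l | k l. True}"
  by (simp add: dyadic_intervals_def dyad_def)

lemma dyad_in_dyadic_intervals: "dyad k l \<in> dyadic_intervals"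
  by (auto simp: dyadic_intervals_eq)

lemma dyadE:
  assumes "J \<in> dyadic_intervals" obtains k l where "J = dyad k l"
  using assms by (auto simp: dyadic_intervals_eq)

lemma powi_two_pred: "(2::real) powi k = 2 * 2 powi (k - 1)"
  using power_int_add_1'[of "2::real" "k - 1"] by simp

lemma powi_two_pos: "(0::real) < 2 powi k"
  by simp

text \<open>In this form disjointness at a fixed scale is immediate and nestedness across scales
  becomes integer division.\<close>

lemma mem_dyad: "x \<in> dyad k l \<longleftrightarrow> \<lfloor>x / 2 powi k\<rfloor> = l"
  by (simp add: dyad_def floor_eq_iff field_simps)

text \<open>A coarser dyadic interval cannot separate two points of a finer one: the floor at level
  \<open>k\<close> is the floor at level \<open>j\<close> divided by a power of two, so it depends
  on the latter alone.\<close>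

lemma dyad_mono_level:
  assumes "j \<le> k" "x \<in> dyad j m" "y \<in> dyad j m"
  shows "x \<in> dyad k l \<longleftrightarrow> y \<in> dyad k l"
proof -
  have "\<lfloor>x / 2 powi k\<rfloor> = \<lfloor>x / 2 powi j\<rfloor> div (2 ^ nat (k - j))" for x :: real
  proof -
    have "(2::real) powi k = 2 powi j * 2 powi (k - j)"
      by (simp flip: power_int_add)
    also have "(2::real) powi (k - j) = real_of_int (2 ^ nat (k - j))"
      using assms(1) by (simp add: power_int_def)
    finally have "x / 2 powi k = (x / 2 powi j) / real_of_int (2 ^ nat (k - j))"
      by simp
    then show ?thesis
      by (simp only: floor_divide_real_eq_div zero_le_power zero_le_numeral)
  qed
  then show ?thesis using assms(2,3) by (simp add: mem_dyad)
qed

lemma dyad_nonempty: "2 powi k * real_of_int l \<in> dyad k l"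
  by (simp add: dyad_def)

lemma dyad_disjoint: "x \<in> dyad k l \<Longrightarrow> x \<in> dyad k l' \<Longrightarrow> l = l'"
  by (simp add: mem_dyad)

lemma Inf_dyad: "Inf (dyad k l) = 2 powi k * real_of_int l"
  and Sup_dyad: "Sup (dyad k l) = 2 powi k * real_of_int (l + 1)"
  by (simp_all add: dyad_def)

lemma measure_dyad: "measure lebesgue (dyad k l) = 2 powi k"
  by (simp add: dyad_def algebra_simps)

lemma dyad_sets: "dyad k l \<in> sets lebesgue" "dyad k l \<in> sets borel"
  by (simp_all add: dyad_def)

lemma dyad_fmeasurable: "dyad k l \<in> fmeasurable lebesgue"
proof -
  have "bounded (dyad k l)"
    unfolding dyad_def by (rule bounded_subset[OF bounded_closed_interval atLeastLessThan_subseteq_atLeastAtMost_iff[THEN iffD2]]) auto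
  then show ?thesis using dyad_sets by (simp add: bounded_set_imp_lmeasurable)
qed

lemma dyad_inject [simp]: "dyad k l = dyad k' l' \<longleftrightarrow> k = k' \<and> l = l'"
proof
  assume eq: "dyad k l = dyad k' l'"
  then have "(2::real) powi k = 2 powi k'"
    by (metis measure_dyad)
  then have "k = k'"
    using power_int_strict_increasing[of k k' "2::real"] power_int_strict_increasing[of k' k "2::real"]
    by (cases k k' rule: linorder_cases) simp_all
  moreover have "real_of_int l = real_of_int l'"
    using arg_cong[OF eq, of Inf] \<open>k = k'\<close> by (simp add: Inf_dyad)
  ultimately show "k = k' \<and> l = l'" by simp
qed simp

lemma left_half_dyad: "left_half (dyad k l) = dyad (k - 1) (2 * l)"
  by (simp add: left_half_def Inf_dyad Sup_dyad dyad_def powi_two_pred[of k] algebra_simps add_divide_distrib)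

lemma right_half_dyad: "right_half (dyad k l) = dyad (k - 1) (2 * l + 1)"
  by (simp add: right_half_def Inf_dyad Sup_dyad dyad_def powi_two_pred[of k] algebra_simps add_divide_distrib)

lemma dyad_split:
  "dyad k l = dyad (k - 1) (2 * l) \<union> dyad (k - 1) (2 * l + 1)"
  by (auto simp: dyad_def powi_two_pred[of k] algebra_simps)

lemma dyad_halves_disjoint: "dyad (k - 1) (2 * l) \<inter> dyad (k - 1) (2 * l + 1) = {}"
  by (auto dest: dyad_disjoint)

lemma indicator_dyad_split:
  "indicator (dyad k l) x = indicator (dyad (k - 1) (2 * l)) x
     + (indicator (dyad (k - 1) (2 * l + 1)) x :: 'a::comm_ring_1)"
  unfolding dyad_split[of k l] by (simp add: indicator_add dyad_halves_disjoint)

section \<open>Orthonormality of the Haar functions\<close>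

lemma haar_dyad: "haar (dyad k l) x =
  (indicator (dyad (k - 1) (2 * l + 1)) x - indicator (dyad (k - 1) (2 * l)) x) / sqrt (2 powi k)"
  by (simp add: haar_def left_half_dyad right_half_dyad measure_dyad)

lemma haar_measurable [measurable]: "haar (dyad k l) \<in> borel_measurable lebesgue"
  unfolding haar_dyad[abs_def] using dyad_sets by measurable

lemma haar_outside: "x \<notin> dyad k l \<Longrightarrow> haar (dyad k l) x = 0"
  unfolding haar_dyad using dyad_split[of k l] by simp

lemma haar_sq: "haar (dyad k l) x * haar (dyad k l) x = indicator (dyad k l) x / 2 powi k"
proof -
  have "x \<notin> dyad (k - 1) (2 * l) \<or> x \<notin> dyad (k - 1) (2 * l + 1)"
    using dyad_halves_disjoint[of k l] by blast
  then show ?thesis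
    by (auto simp: haar_dyad indicator_dyad_split[of k l] split: split_indicator)
qed

lemma indicator_dyad_integrable:
  "integrable lebesgue (indicator (dyad k l) :: real \<Rightarrow> real)"
  using fmeasurableD2[OF dyad_fmeasurable] dyad_sets
  by (intro integrable_real_indicator) (auto simp: less_top)

lemma integral_haar: "(LINT x|lebesgue. haar (dyad k l) x) = 0"
  using indicator_dyad_integrable by (simp add: haar_dyad measure_dyad)

text \<open>The halves of \<open>dyad k l\<close> have level \<open>k - 1\<close>, which is still at
  least \<open>j\<close>, so both points lie in the same half or in neither.\<close>

lemma haar_const:
  assumes "j < k" "x \<in> dyad j m" "y \<in> dyad j m"
  shows "haar (dyad k l) x = haar (dyad k l) y"
  using dyad_mono_level[of j "k - 1" x m y] assms by (simp add: haar_dyad indicator_def)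

text \<open>The coarser Haar function is constant on the support of the finer one, and the finer one
  has mean zero.\<close>

lemma haar_ortho_level:
  assumes "j < k"
  shows "(LINT x|lebesgue. haar (dyad j m) x * haar (dyad k l) x) = 0"
proof -
  define c where "c = haar (dyad k l) (2 powi j * real_of_int m)"
  have "haar (dyad j m) x * haar (dyad k l) x = haar (dyad j m) x * c" for x
    using haar_const[OF assms _ dyad_nonempty, of x m l] haar_outside[of x j m]
    unfolding c_def by fastforce
  then show ?thesis by (simp only: integral_mult_left_zero integral_haar mult_zero_left)
qed

lemma haar_L2: "(\<lambda>x. complex_of_real (haar (dyad k l) x)) \<in> L2"
  using indicator_dyad_integrable[of k l]
  by (auto simp: L2_def power2_eq_square haar_sq)

lemma haar_orthonormal: "orthonormal_on dyadic_intervals haar"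
  unfolding orthonormal_on_def
proof (intro conjI ballI)
  fix J assume "J \<in> dyadic_intervals"
  then show "(\<lambda>x. complex_of_real (haar J x)) \<in> L2"
    by (elim dyadE) (simp add: haar_L2)
next
  fix J L assume "J \<in> dyadic_intervals" "L \<in> dyadic_intervals"
  then obtain k l j m where [simp]: "J = dyad k l" "L = dyad j m"
    by (elim dyadE)
  consider "j < k" | "k < j" | "j = k" "l \<noteq> m" | "j = k" "l = m" by linarith
  then show "(LINT x|lebesgue. haar J x * haar L x) = (if J = L then 1 else 0)"
  proof cases
    case 1
    then show ?thesis using haar_ortho_level[of j k m l] by (simp add: mult.commute)
  next
    case 2
    then show ?thesis using haar_ortho_level[of k j l m] by simp
  next
    case 3
    then have "haar J x * haar L x = 0" for x
      using haar_outside[of x k l] haar_outside[of x k m] dyad_disjoint[of x k l m] by auto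
    then have "(\<lambda>x. haar J x * haar L x) = (\<lambda>x. 0)" by blast
    then show ?thesis using 3 by simp
  next
    case 4
    then show ?thesis by (simp add: haar_sq measure_dyad)
  qed
qed

lemma dyadic_half [simp]:
  "J \<in> dyadic_intervals \<Longrightarrow> left_half J \<in> dyadic_intervals"
  "J \<in> dyadic_intervals \<Longrightarrow> right_half J \<in> dyadic_intervals"
  by (auto elim!: dyadE simp: left_half_dyad right_half_dyad dyad_in_dyadic_intervals)

lemma inj_on_left_half: "inj_on left_half dyadic_intervals"
  by (auto intro!: inj_onI elim!: dyadE simp: left_half_dyad)

lemma inj_on_right_half: "inj_on right_half dyadic_intervals"
  by (auto intro!: inj_onI elim!: dyadE simp: right_half_dyad)

text \<open>Parity: left halves have even position, right halves odd position.\<close>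

lemma left_half_neq_right_half:
  "J \<in> dyadic_intervals \<Longrightarrow> L \<in> dyadic_intervals \<Longrightarrow> left_half J \<noteq> right_half L"
  by (auto elim!: dyadE simp: left_half_dyad right_half_dyad) presburger

section \<open>The shifted Haar functions and the Haar coefficients of the shift\<close>

lemma L2_coeff_shifted_haar:
  assumes "J \<in> dyadic_intervals" "f \<in> L2"
  shows "L2_coeff f (shifted_haar J)
       = (L2_coeff f (haar (right_half J)) - L2_coeff f (haar (left_half J))) / complex_of_real (sqrt 2)"
proof -
  have "(\<lambda>x. complex_of_real (haar (right_half J) x)) \<in> L2"
       "(\<lambda>x. complex_of_real (haar (left_half J) x)) \<in> L2"
    using assms by (auto intro!: orthonormal_onD(1)[OF haar_orthonormal])
  from this[THEN L2_integrable_mult[OF assms(2)]] show ?thesis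
    by (simp add: L2_coeff_def shifted_haar_def right_diff_distrib diff_divide_distrib)
qed

lemma shifted_haar_L2:
  assumes "J \<in> dyadic_intervals"
  shows "(\<lambda>x. complex_of_real (shifted_haar J x)) \<in> L2"
proof -
  have "(\<lambda>x. complex_of_real (1 / sqrt 2) *
      (complex_of_real (haar (right_half J) x) - complex_of_real (haar (left_half J) x))) \<in> L2"
    using assms by (intro L2_cmult L2_diff orthonormal_onD(1)[OF haar_orthonormal]) auto
  then show ?thesis by (simp add: shifted_haar_def)
qed

text \<open>An interval is a child of only one dyadic interval, and on only one side, so
  orthonormality of \<open>haar\<close> leaves just the term with \<open>J = L\<close>. The pairing
  is symmetric in real functions, which lets \<open>L2_coeff_shifted_haar\<close> apply.\<close>

lemma L2_coeff_of_shifted_haar: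
  assumes "J \<in> dyadic_intervals" "L \<in> dyadic_intervals"
  shows "L2_coeff (\<lambda>x. complex_of_real (shifted_haar J x)) (haar (left_half L))
           = (if J = L then - 1 / complex_of_real (sqrt 2) else 0)" (is ?left)
    and "L2_coeff (\<lambda>x. complex_of_real (shifted_haar J x)) (haar (right_half L))
           = (if J = L then 1 / complex_of_real (sqrt 2) else 0)" (is ?right)
proof -
  have sym: "L2_coeff (\<lambda>x. complex_of_real (f x)) g = L2_coeff (\<lambda>x. complex_of_real (g x)) f" for f g
    by (simp add: L2_coeff_def mult.commute)
  note o = haar_orthonormal[THEN orthonormal_onD(1)] haar_orthonormal[THEN orthonormal_onD(2)]
  show ?left
    using assms left_half_neq_right_half[of L J] inj_onD[OF inj_on_left_half, of J L]
    by (subst sym) (auto simp: L2_coeff_shifted_haar o)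
  show ?right
    using assms left_half_neq_right_half[of J L] inj_onD[OF inj_on_right_half, of J L]
    by (subst sym) (auto simp: L2_coeff_shifted_haar o)
qed

text \<open>The two children contribute 1/2 each when \<open>J = L\<close>, and nothing otherwise.
  This orthonormality is what makes the series for the shift converge.\<close>

lemma shifted_haar_orthonormal: "orthonormal_on dyadic_intervals shifted_haar"
  unfolding orthonormal_on_def
proof (intro conjI ballI shifted_haar_L2)
  fix J L assume JL: "J \<in> dyadic_intervals" "L \<in> dyadic_intervals"
  have "complex_of_real (LINT x|lebesgue. shifted_haar J x * shifted_haar L x)
      = L2_coeff (\<lambda>x. complex_of_real (shifted_haar J x)) (shifted_haar L)"
    by (simp only: L2_coeff_def of_real_mult flip: integral_complex_of_real)
  also have "\<dots> = (if J = L then 1 else 0)"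
    using JL by (simp add: L2_coeff_shifted_haar shifted_haar_L2 L2_coeff_of_shifted_haar flip: of_real_mult)
  finally show "(LINT x|lebesgue. shifted_haar J x * shifted_haar L x) = (if J = L then 1 else 0)"
    by (simp split: if_splits)
qed

lemma haar_coeff_eq: "haar_coeff f J = L2_coeff f (haar J)"
  by (simp add: haar_coeff_def L2_coeff_def)

text \<open>Justifies the choice operator: Bessel's inequality bounds the squared Haar coefficients
  of \<open>f\<close>, and Riesz--Fischer sums them against \<open>shifted_haar\<close>.\<close>

lemma is_haar_shift_haar_shift:
  assumes "f \<in> L2"
  shows "is_haar_shift f (haar_shift f)"
proof -
  obtain g where "is_haar_shift f g"
    using riesz_fischer[OF shifted_haar_orthonormal bessel_finite[OF haar_orthonormal _ _ assms]]
    unfolding is_haar_shift_def haar_coeff_eq by blast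
  then show ?thesis unfolding haar_shift_def by (metis someI)
qed

lemma haar_coeff_haar_shift:
  assumes f: "f \<in> L2" and J: "J \<in> dyadic_intervals"
  shows "haar_coeff (haar_shift f) (left_half J) = - haar_coeff f J / complex_of_real (sqrt 2)" (is ?left)
    and "haar_coeff (haar_shift f) (right_half J) = haar_coeff f J / complex_of_real (sqrt 2)" (is ?right)
proof -
  let ?u = "\<lambda>F x. \<Sum>J\<in>F. haar_coeff f J * complex_of_real (shifted_haar J x)"
  note s = is_haar_shift_haar_shift[OF f, unfolded is_haar_shift_def]
  have u: "?u F \<in> L2" if "F \<subseteq> dyadic_intervals" for F
    using that by (rule L2_sum_orthonormal[OF shifted_haar_orthonormal])
  have main: "haar_coeff (haar_shift f) L = haar_coeff f J * c"
    if L: "L \<in> dyadic_intervals"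
      and c: "\<And>M. M \<in> dyadic_intervals \<Longrightarrow>
        L2_coeff (\<lambda>x. complex_of_real (shifted_haar M x)) (haar L) = (if M = J then c else 0)" for L c
  proof -
    \<comment> \<open>Once \<open>F\<close> contains \<open>J\<close>, the coefficient of the
      partial sum no longer changes, so its limit can be read off.\<close>
    have "L2_coeff (?u F) (haar L) = haar_coeff f J * c"
      if F: "finite F" "F \<subseteq> dyadic_intervals" "{J} \<subseteq> F" for F
    proof -
      have "L2_coeff (?u F) (haar L)
          = (\<Sum>M\<in>F. haar_coeff f M * L2_coeff (\<lambda>x. complex_of_real (shifted_haar M x)) (haar L))"
        using F L by (intro L2_coeff_sum shifted_haar_L2 orthonormal_onD(1)[OF haar_orthonormal]) auto
      also have "\<dots> = (\<Sum>M\<in>F. if J = M then haar_coeff f M * c else 0)"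
        by (intro sum.cong refl) (use F in \<open>simp add: c subset_iff\<close>)
      finally show ?thesis using F by simp
    qed
    then have "\<forall>\<^sub>F F in finite_subsets_at_top dyadic_intervals. L2_coeff (?u F) (haar L) = haar_coeff f J * c"
      unfolding eventually_finite_subsets_at_top using J by blast
    then have "((\<lambda>F. L2_coeff (?u F) (haar L)) \<longlongrightarrow> haar_coeff f J * c) (finite_subsets_at_top dyadic_intervals)"
      by (rule tendsto_eventually)
    moreover have "((\<lambda>F. L2_coeff (?u F) (haar L)) \<longlongrightarrow> L2_coeff (haar_shift f) (haar L))
        (finite_subsets_at_top dyadic_intervals)"
      using s u L by (intro L2_coeff_limit[OF haar_orthonormal]) auto
    ultimately show ?thesis
      unfolding haar_coeff_eq[of "haar_shift f"] by (intro tendsto_unique[of "finite_subsets_at_top dyadic_intervals"]) auto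
  qed
  show ?left
    using main[of "left_half J" "- 1 / complex_of_real (sqrt 2)"] J
    by (simp add: L2_coeff_of_shifted_haar)
  show ?right
    using main[of "right_half J" "1 / complex_of_real (sqrt 2)"] J
    by (simp add: L2_coeff_of_shifted_haar)
qed

subsection \<open>Completeness of the Haar system on a dyadic interval\<close>

lemma indicator_dyad_L2: "(\<lambda>x. indicator (dyad k l) x :: complex) \<in> L2"
proof -
  have "indicator (dyad k l) x = complex_of_real (indicator (dyad k l) x)" for x
    by (simp split: split_indicator)
  moreover have "(norm (complex_of_real (indicator (dyad k l) x)))\<^sup>2 = indicator (dyad k l) x" for x
    by (simp split: split_indicator)
  ultimately show ?thesis
    using indicator_dyad_integrable[of k l] by (simp add: L2_def)
qed

definition dyad_integral :: "(real \<Rightarrow> complex) \<Rightarrow> int \<Rightarrow> int \<Rightarrow> complex" where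
  "dyad_integral f k l = (LINT x|lebesgue. indicator (dyad k l) x * f x)"

definition dyad_energy :: "(real \<Rightarrow> complex) \<Rightarrow> int \<Rightarrow> int \<Rightarrow> real" where
  "dyad_energy f k l = (L2_norm (\<lambda>x. indicator (dyad k l) x * f x))\<^sup>2"

lemma dyad_integrable: "f \<in> L2 \<Longrightarrow> integrable lebesgue (\<lambda>x. indicator (dyad k l) x * f x)"
  by (rule L2_integrable_mult[OF indicator_dyad_L2])

lemma dyad_L2: "f \<in> L2 \<Longrightarrow> (\<lambda>x. indicator (dyad k l) x * f x) \<in> L2"
  by (rule L2_indicator) (auto simp: dyad_sets)

lemma dyad_integral_split:
  assumes "f \<in> L2"
  shows "dyad_integral f k l = dyad_integral f (k - 1) (2 * l) + dyad_integral f (k - 1) (2 * l + 1)"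
  using dyad_integrable[OF assms]
  by (simp add: dyad_integral_def indicator_dyad_split[of k l] distrib_right)

lemma dyad_energy_split:
  assumes "f \<in> L2"
  shows "dyad_energy f k l = dyad_energy f (k - 1) (2 * l) + dyad_energy f (k - 1) (2 * l + 1)"
proof -
  have "(norm (indicator (dyad k l) x * f x))\<^sup>2
      = (norm (indicator (dyad (k - 1) (2 * l)) x * f x))\<^sup>2
      + (norm (indicator (dyad (k - 1) (2 * l + 1)) x * f x))\<^sup>2" for x
    using dyad_split[of k l] dyad_halves_disjoint[of k l] by (auto split: split_indicator)
  then show ?thesis
    using dyad_L2[OF assms, THEN L2_integrable_sq] by (simp add: dyad_energy_def L2_norm_sq)
qed

lemma haar_coeff_dyad:
  assumes "f \<in> L2"
  shows "haar_coeff f (dyad k l)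
    = (dyad_integral f (k - 1) (2 * l + 1) - dyad_integral f (k - 1) (2 * l)) / complex_of_real (sqrt (2 powi k))"
proof -
  have "f x * complex_of_real (haar (dyad k l) x)
     = (indicator (dyad (k - 1) (2 * l + 1)) x * f x - indicator (dyad (k - 1) (2 * l)) x * f x)
        / complex_of_real (sqrt (2 powi k))" for x
    by (simp add: haar_dyad split: split_indicator)
  then show ?thesis
    using dyad_integrable[OF assms] by (simp add: haar_coeff_def dyad_integral_def)
qed

lemma parallelogram_complex:
  "(norm (a + b))\<^sup>2 + (norm (b - a))\<^sup>2 = 2 * (norm a)\<^sup>2 + 2 * (norm b)\<^sup>2" for a b :: complex
  unfolding cmod_power2 by (simp add: power2_eq_square algebra_simps)

text \<open>The parallelogram law for the integrals over the two halves. Replacing \<open>f\<close>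
  by its averages on the halves, instead of its average on the whole interval, raises the squared
  norm by exactly the squared Haar coefficient.\<close>

lemma haar_coeff_telescope:
  assumes "f \<in> L2"
  shows "(norm (dyad_integral f (k - 1) (2 * l)))\<^sup>2 / 2 powi (k - 1)
       + (norm (dyad_integral f (k - 1) (2 * l + 1)))\<^sup>2 / 2 powi (k - 1)
       = (norm (dyad_integral f k l))\<^sup>2 / 2 powi k + (norm (haar_coeff f (dyad k l)))\<^sup>2"
  using parallelogram_complex[of "dyad_integral f (k - 1) (2 * l)" "dyad_integral f (k - 1) (2 * l + 1)"]
  unfolding haar_coeff_dyad[OF assms] dyad_integral_split[OF assms, of k l]
  by (simp add: norm_divide power_divide powi_two_pred[of k] field_simps)

text \<open>Completing the square in \<open>c\<close>; the last term vanishes when \<open>c\<close>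
  is the mean of \<open>f\<close> on the interval.\<close>

lemma dyad_energy_minus_const:
  assumes "f \<in> L2"
  shows "(L2_norm (\<lambda>x. indicator (dyad k l) x * (f x - c)))\<^sup>2
       = dyad_energy f k l - (norm (dyad_integral f k l))\<^sup>2 / 2 powi k
         + (norm (dyad_integral f k l - c * complex_of_real (2 powi k)))\<^sup>2 / 2 powi k"
proof -
  let ?K = "dyad k l"
  have "(LINT x|lebesgue. (indicator ?K x * f x) * cnj (c * indicator ?K x))
      = (LINT x|lebesgue. cnj c * (indicator ?K x * f x))"
    by (intro Bochner_Integration.integral_cong) (auto split: split_indicator)
  then have inner: "(LINT x|lebesgue. (indicator ?K x * f x) * cnj (c * indicator ?K x))
      = cnj c * dyad_integral f k l"
    by (simp only: integral_mult_right_zero dyad_integral_def)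
  have "(norm (c * indicator ?K x))\<^sup>2 = (norm c)\<^sup>2 * indicator ?K x" for x :: real
    by (simp split: split_indicator)
  then have const: "(L2_norm (\<lambda>x. c * indicator ?K x))\<^sup>2 = (norm c)\<^sup>2 * 2 powi k"
    by (simp add: L2_norm_sq measure_dyad)
  have eq: "indicator ?K x * (f x - c) = indicator ?K x * f x - c * indicator ?K x" for x
    by (simp add: algebra_simps)
  have norm_eq: "(L2_norm (\<lambda>x. indicator ?K x * (f x - c)))\<^sup>2
     = dyad_energy f k l + (norm c)\<^sup>2 * 2 powi k - 2 * Re (cnj c * dyad_integral f k l)"
    unfolding eq by (subst L2_norm_diff_sq[OF dyad_L2[OF assms] L2_cmult[OF indicator_dyad_L2]])
      (simp only: inner const dyad_energy_def)
  have "(norm (m - c * complex_of_real t))\<^sup>2 / t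
      = (norm m)\<^sup>2 / t + (norm c)\<^sup>2 * t - 2 * Re (cnj c * m)" if "t > 0" for m t
    using that unfolding cmod_power2 by (simp add: power2_eq_square field_simps)
  from norm_eq this[OF powi_two_pos, of "dyad_integral f k l" k] show ?thesis
    by linarith
qed

text \<open>Cauchy--Schwarz against the indicator, obtained by taking \<open>c\<close> to be the
  mean.\<close>

lemma dyad_mean_sq_le: "f \<in> L2 \<Longrightarrow> (norm (dyad_integral f k l))\<^sup>2 / 2 powi k \<le> dyad_energy f k l"
  using dyad_energy_minus_const[of f k l "dyad_integral f k l / complex_of_real (2 powi k)"]
    zero_le_power2[of "L2_norm (\<lambda>x. indicator (dyad k l) x * (f x - dyad_integral f k l / complex_of_real (2 powi k)))"]
  by simp

lemma dyad_subset_level: "dyad j m \<subseteq> dyad k l \<Longrightarrow> j \<le> k"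
proof (rule ccontr)
  assume "dyad j m \<subseteq> dyad k l" "\<not> j \<le> k"
  then have "measure lebesgue (dyad j m) \<le> measure lebesgue (dyad k l)"
    by (intro measure_mono_fmeasurable dyad_fmeasurable dyad_sets)
  moreover have "(2::real) powi k < 2 powi j"
    using \<open>\<not> j \<le> k\<close> by (intro power_int_strict_increasing) simp_all
  ultimately show False by (simp add: measure_dyad)
qed

text \<open>Induction on the number \<open>n\<close> of generations of subintervals put into
  \<open>F\<close>. The energy defect of an interval is the sum of the defects of its halves plus a
  squared Haar coefficient. After \<open>n\<close> halvings \<open>g\<close> is constant up to
  \<open>e\<close> on each piece; both error terms are additive over halves, so they do not grow
  with \<open>n\<close>.\<close>

lemma haar_energy_approx:
  assumes f: "f \<in> L2" and g: "g \<in> L2" and "0 \<le> e"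
    and osc: "\<And>x y. x \<in> dyad k l \<Longrightarrow> y \<in> dyad k l \<Longrightarrow> \<bar>x - y\<bar> \<le> 2 powi k / 2 ^ n \<Longrightarrow> norm (g x - g y) \<le> e"
  shows "\<exists>F. finite F \<and> F \<subseteq> dyadic_intervals \<and> (\<forall>J\<in>F. J \<subseteq> dyad k l) \<and>
    dyad_energy f k l - (norm (dyad_integral f k l))\<^sup>2 / 2 powi k
      \<le> (\<Sum>J\<in>F. (norm (haar_coeff f J))\<^sup>2) + 2 * dyad_energy (\<lambda>x. f x - g x) k l + 2 * e\<^sup>2 * 2 powi k"
  using osc
proof (induction n arbitrary: k l)
  case 0
  let ?K = "dyad k l"
  \<comment> \<open>The value of \<open>g\<close> at the left endpoint. For \<open>n = 0\<close> the
    oscillation hypothesis covers all pairs of points of the interval.\<close>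
  define c where "c = g (2 powi k * real_of_int l)"
  have near: "norm (g x - c) \<le> e" if "x \<in> ?K" for x
    unfolding c_def by (rule 0[OF that dyad_nonempty]) (use that in \<open>auto simp: dyad_def algebra_simps\<close>)
  have gc: "(\<lambda>x. indicator ?K x * (g x - c)) \<in> L2"
    using L2_diff[OF dyad_L2[OF g, of k l] L2_cmult[OF indicator_dyad_L2[of k l], of c]]
    by (simp add: algebra_simps)
  have "dyad_energy f k l - (norm (dyad_integral f k l))\<^sup>2 / 2 powi k
      \<le> (L2_norm (\<lambda>x. indicator ?K x * (f x - c)))\<^sup>2"
    using dyad_energy_minus_const[OF f, of k l c] by simp
  also have "\<dots> = (L2_norm (\<lambda>x. indicator ?K x * (f x - g x) + indicator ?K x * (g x - c)))\<^sup>2"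
    by (simp add: algebra_simps)
  also have "\<dots> \<le> 2 * dyad_energy (\<lambda>x. f x - g x) k l + 2 * (L2_norm (\<lambda>x. indicator ?K x * (g x - c)))\<^sup>2"
    unfolding dyad_energy_def by (intro L2_norm_add_sq_le gc dyad_L2 L2_diff f g)
  also have "(L2_norm (\<lambda>x. indicator ?K x * (g x - c)))\<^sup>2 \<le> (LINT x|lebesgue. e\<^sup>2 * indicator ?K x)"
    unfolding L2_norm_sq
  proof (rule integral_mono)
    show "integrable lebesgue (\<lambda>x. (norm (indicator ?K x * (g x - c)))\<^sup>2)"
      by (rule L2_integrable_sq[OF gc])
    show "integrable lebesgue (\<lambda>x. e\<^sup>2 * indicator ?K x)"
      by (rule integrable_mult_right[OF indicator_dyad_integrable])
    show "(norm (indicator ?K x * (g x - c)))\<^sup>2 \<le> e\<^sup>2 * indicator ?K x" for x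
      using near[of x] by (auto split: split_indicator intro: power_mono)
  qed
  also have "\<dots> = e\<^sup>2 * 2 powi k"
    by (simp add: measure_dyad)
  finally show ?case by (intro exI[of _ "{}"]) (simp add: mult.assoc)
next
  case (Suc n)
  let ?L = "dyad (k - 1) (2 * l)" and ?R = "dyad (k - 1) (2 * l + 1)"
  \<comment> \<open>Halving the interval while lowering \<open>n\<close> keeps the admissible
    distance, so the oscillation hypothesis is inherited by both halves.\<close>
  have pow: "2 powi (k - 1) / 2 ^ n = 2 powi k / (2::real) ^ Suc n"
    by (simp add: powi_two_pred[of k])
  have sub: "?L \<subseteq> dyad k l" "?R \<subseteq> dyad k l"
    using dyad_split[of k l] by auto
  obtain F1 where F1: "finite F1" "F1 \<subseteq> dyadic_intervals" "\<forall>J\<in>F1. J \<subseteq> ?L"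
    "dyad_energy f (k - 1) (2 * l) - (norm (dyad_integral f (k - 1) (2 * l)))\<^sup>2 / 2 powi (k - 1)
      \<le> (\<Sum>J\<in>F1. (norm (haar_coeff f J))\<^sup>2) + 2 * dyad_energy (\<lambda>x. f x - g x) (k - 1) (2 * l) + 2 * e\<^sup>2 * 2 powi (k - 1)"
    using Suc.IH[of "k - 1" "2 * l", unfolded pow, OF Suc.prems[OF subsetD[OF sub(1)] subsetD[OF sub(1)]]]
    by blast
  obtain F2 where F2: "finite F2" "F2 \<subseteq> dyadic_intervals" "\<forall>J\<in>F2. J \<subseteq> ?R"
    "dyad_energy f (k - 1) (2 * l + 1) - (norm (dyad_integral f (k - 1) (2 * l + 1)))\<^sup>2 / 2 powi (k - 1)
      \<le> (\<Sum>J\<in>F2. (norm (haar_coeff f J))\<^sup>2) + 2 * dyad_energy (\<lambda>x. f x - g x) (k - 1) (2 * l + 1) + 2 * e\<^sup>2 * 2 powi (k - 1)"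
    using Suc.IH[of "k - 1" "2 * l + 1", unfolded pow, OF Suc.prems[OF subsetD[OF sub(2)] subsetD[OF sub(2)]]]
    by blast
  have "dyad k l \<notin> F1 \<union> F2"
    using F1(3) F2(3) dyad_subset_level[of k l "k - 1"] by fastforce
  \<comment> \<open>A common member would lie in two disjoint halves, but dyadic intervals are
    nonempty.\<close>
  moreover have "F1 \<inter> F2 = {}"
  proof -
    have "J = {}" if "J \<in> F1" "J \<in> F2" for J
      using that F1(3) F2(3) dyad_halves_disjoint[of k l] by blast
    moreover have "{} \<notin> dyadic_intervals"
      using dyad_nonempty by (auto elim!: dyadE)
    ultimately show ?thesis using F1(2) by blast
  qed
  ultimately have "(\<Sum>J\<in>insert (dyad k l) (F1 \<union> F2). (norm (haar_coeff f J))\<^sup>2)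
      = (norm (haar_coeff f (dyad k l)))\<^sup>2 + (\<Sum>J\<in>F1. (norm (haar_coeff f J))\<^sup>2) + (\<Sum>J\<in>F2. (norm (haar_coeff f J))\<^sup>2)"
    using F1(1) F2(1) by (simp add: sum.union_disjoint)
  moreover have "2 * e\<^sup>2 * 2 powi k = 2 * e\<^sup>2 * 2 powi (k - 1) + 2 * e\<^sup>2 * 2 powi (k - 1)"
    by (simp add: powi_two_pred[of k])
  ultimately have "dyad_energy f k l - (norm (dyad_integral f k l))\<^sup>2 / 2 powi k
      \<le> (\<Sum>J\<in>insert (dyad k l) (F1 \<union> F2). (norm (haar_coeff f J))\<^sup>2)
        + 2 * dyad_energy (\<lambda>x. f x - g x) k l + 2 * e\<^sup>2 * 2 powi k"
    using F1(4) F2(4) haar_coeff_telescope[OF f, of k l] dyad_energy_split[OF f, of k l]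
      dyad_energy_split[OF L2_diff[OF f g], of k l] by linarith
  moreover have "finite (insert (dyad k l) (F1 \<union> F2))"
    using F1(1) F2(1) by simp
  moreover have "insert (dyad k l) (F1 \<union> F2) \<subseteq> dyadic_intervals"
    using F1(2) F2(2) dyad_in_dyadic_intervals[of k l] by simp
  moreover have "\<forall>J\<in>insert (dyad k l) (F1 \<union> F2). J \<subseteq> dyad k l"
  proof
    fix J assume "J \<in> insert (dyad k l) (F1 \<union> F2)"
    then consider "J = dyad k l" | "J \<in> F1" | "J \<in> F2" by blast
    then show "J \<subseteq> dyad k l"
    proof cases
      case 2
      from bspec[OF F1(3) this] show ?thesis using sub(1) by (rule subset_trans)
    next
      case 3
      from bspec[OF F2(3) this] show ?thesis using sub(2) by (rule subset_trans)
    qed simp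
  qed
  ultimately show ?case by (intro exI conjI)
qed

section \<open>Approximation in the square norm by uniformly continuous functions\<close>

text \<open>For \<open>B > 0\<close> this is the radial retraction onto the closed ball of radius
  \<open>B\<close>; the denominator never drops below \<open>B\<close>, which makes continuity
  evident.\<close>

definition clamp_norm :: "real \<Rightarrow> complex \<Rightarrow> complex" where
  "clamp_norm B z = complex_of_real (B / max B (norm z)) * z"

lemma continuous_clamp_norm: "B > 0 \<Longrightarrow> continuous_on UNIV (clamp_norm B)"
  unfolding clamp_norm_def[abs_def] by (intro continuous_intros) (auto simp: max_def)

lemma norm_clamp_norm: "B > 0 \<Longrightarrow> norm (clamp_norm B z) = min B (norm z)"
  unfolding clamp_norm_def norm_mult norm_of_real by (simp add: max_def min_def)

lemma clamp_norm_eq: "B > 0 \<Longrightarrow> norm z \<le> B \<Longrightarrow> clamp_norm B z = z"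
  by (simp add: clamp_norm_def max_def)

lemma clamp_norm_measurable [measurable]: "B > 0 \<Longrightarrow> clamp_norm B \<in> borel_measurable borel"
  by (intro borel_measurable_continuous_onI continuous_clamp_norm)

text \<open>Dominated convergence for the truncation radii \<open>Suc n\<close>: at each point the
  truncation is eventually inactive, and the error is dominated by
  \<open>4 * (norm (f x))\<^sup>2\<close>.\<close>

lemma L2_approx_bounded:
  assumes "f \<in> L2" "0 < e"
  obtains B where "0 < B" "(\<lambda>x. clamp_norm B (f x)) \<in> L2" "(L2_norm (\<lambda>x. f x - clamp_norm B (f x)))\<^sup>2 < e"
proof -
  note [measurable] = L2_measurable[OF assms(1)]
  let ?d = "\<lambda>n x. (norm (f x - clamp_norm (real (Suc n)) (f x)))\<^sup>2"
  have L: "(\<lambda>x. clamp_norm (real (Suc n)) (f x)) \<in> L2" for n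
    by (rule L2_bounded[where C=1 and g=f]) (use assms in \<open>auto simp: norm_clamp_norm\<close>)
  have "(\<lambda>n. LINT x|lebesgue. ?d n x) \<longlonglongrightarrow> (LINT x::real|lebesgue. 0)"
  proof (rule integral_dominated_convergence[where w="\<lambda>x. 4 * (norm (f x))\<^sup>2"])
    show "integrable lebesgue (\<lambda>x. 4 * (norm (f x))\<^sup>2)"
      using assms by (intro integrable_mult_right L2_integrable_sq)
    show "AE x in lebesgue. (\<lambda>n. ?d n x) \<longlonglongrightarrow> 0"
    proof (intro AE_I2 tendsto_eventually)
      fix x
      obtain N where N: "norm (f x) \<le> real N" using real_arch_simple by blast
      show "\<forall>\<^sub>F n in sequentially. ?d n x = 0"
        using N by (intro eventually_sequentiallyI[of N]) (simp add: clamp_norm_eq)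
    qed
    show "AE x in lebesgue. norm (?d n x) \<le> 4 * (norm (f x))\<^sup>2" for n
    proof (intro AE_I2)
      fix x
      have "norm (f x - clamp_norm (real (Suc n)) (f x)) \<le> norm (f x) + norm (f x)"
        using norm_triangle_ineq4[of "f x" "clamp_norm (real (Suc n)) (f x)"]
          norm_clamp_norm[of "real (Suc n)" "f x"] by simp
      then have "?d n x \<le> (norm (f x) + norm (f x))\<^sup>2"
        by (intro power_mono) auto
      then show "norm (?d n x) \<le> 4 * (norm (f x))\<^sup>2"
        by (simp add: power2_eq_square)
    qed
  qed measurable
  then have "(\<lambda>n. LINT x|lebesgue. ?d n x) \<longlonglongrightarrow> 0" by simp
  from order_tendstoD(2)[OF this \<open>0 < e\<close>]
  obtain n where "(LINT x|lebesgue. ?d n x) < e"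
    by (auto simp: eventually_sequentially)
  with that[of "real (Suc n)"] L[of n] show ?thesis
    by (simp add: L2_norm_sq)
qed

text \<open>A measurable function is almost everywhere a limit of continuous ones. Clamping these
  keeps them continuous and bounds them by \<open>B\<close>, so dominated convergence applies on the
  interval, which has finite measure.\<close>

lemma bounded_approx_continuous:
  assumes f: "f \<in> borel_measurable lebesgue" and "0 < B" "0 < e"
  obtains g where "continuous_on UNIV g" "\<And>x. norm (g x) \<le> B"
    "(L2_norm (\<lambda>x. indicator (dyad k l) x * (clamp_norm B (f x) - g x)))\<^sup>2 < e"
proof -
  note [measurable] = f dyad_sets
  have "f measurable_on UNIV"
    using lebesgue_measurable_imp_measurable_on[of f UNIV] f by simp
  then obtain N G where N: "negligible N" and G: "\<And>n. continuous_on UNIV (G n)"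
    and lim: "\<And>x. x \<notin> N \<Longrightarrow> (\<lambda>n. G n x) \<longlonglongrightarrow> f x"
    by (auto simp: measurable_on_def)
  have cont: "continuous_on UNIV (\<lambda>x. clamp_norm B (G n x))" for n
    by (rule continuous_on_compose2[OF continuous_clamp_norm G]) (use \<open>0 < B\<close> in auto)
  then have [measurable]: "(\<lambda>x. clamp_norm B (G n x)) \<in> borel_measurable lebesgue" for n
    by (intro measurable_completion) (simp add: borel_measurable_continuous_onI)
  have [measurable]: "(\<lambda>x. clamp_norm B (f x)) \<in> borel_measurable lebesgue"
    using clamp_norm_measurable[OF \<open>0 < B\<close>] by measurable
  let ?d = "\<lambda>n x. (norm (indicator (dyad k l) x * (clamp_norm B (f x) - clamp_norm B (G n x))))\<^sup>2"
  have AE: "AE x in lebesgue. x \<notin> N"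
    using N by (intro AE_not_in) (simp add: negligible_iff_null_sets)
  have "(\<lambda>n. LINT x|lebesgue. ?d n x) \<longlonglongrightarrow> (LINT x::real|lebesgue. 0)"
  proof (rule integral_dominated_convergence[where w="\<lambda>x. (2 * B)\<^sup>2 * indicator (dyad k l) x"])
    show "integrable lebesgue (\<lambda>x. (2 * B)\<^sup>2 * indicator (dyad k l) x)"
      by (rule integrable_mult_right[OF indicator_dyad_integrable])
    show "AE x in lebesgue. (\<lambda>n. ?d n x) \<longlonglongrightarrow> 0"
      using AE
    proof eventually_elim
      case (elim x)
      have "isCont (clamp_norm B) (f x)"
        using continuous_clamp_norm[OF \<open>0 < B\<close>] by (simp add: continuous_on_eq_continuous_at)
      then have "(\<lambda>n. clamp_norm B (G n x)) \<longlonglongrightarrow> clamp_norm B (f x)"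
        using lim[OF elim] by (rule isCont_tendsto_compose)
      then have "(\<lambda>n. ?d n x) \<longlonglongrightarrow> (norm (indicator (dyad k l) x * (clamp_norm B (f x) - clamp_norm B (f x))))\<^sup>2"
        by (intro tendsto_intros)
      then show ?case by simp
    qed
    show "AE x in lebesgue. norm (?d n x) \<le> (2 * B)\<^sup>2 * indicator (dyad k l) x" for n
    proof (intro AE_I2)
      fix x
      have "norm (clamp_norm B (f x) - clamp_norm B (G n x)) \<le> 2 * B"
        using norm_triangle_ineq4[of "clamp_norm B (f x)" "clamp_norm B (G n x)"]
          norm_clamp_norm[OF \<open>0 < B\<close>, of "f x"] norm_clamp_norm[OF \<open>0 < B\<close>, of "G n x"] by linarith
      from power_mono[OF this norm_ge_zero, of 2]
      show "norm (?d n x) \<le> (2 * B)\<^sup>2 * indicator (dyad k l) x"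
        by (auto split: split_indicator)
    qed
  qed measurable
  then have "(\<lambda>n. LINT x|lebesgue. ?d n x) \<longlonglongrightarrow> 0" by simp
  from order_tendstoD(2)[OF this \<open>0 < e\<close>]
  obtain n where "(LINT x|lebesgue. ?d n x) < e"
    by (auto simp: eventually_sequentially)
  then show ?thesis
    using cont[of n] norm_clamp_norm[OF \<open>0 < B\<close>]
    by (intro that[of "\<lambda>x. clamp_norm B (G n x)"]) (auto simp: L2_norm_sq)
qed

lemma L2_approx_uniformly_continuous:
  assumes f: "f \<in> L2" and "0 < e"
  obtains g where "g \<in> L2" "uniformly_continuous_on (dyad k l) g" "dyad_energy (\<lambda>x. f x - g x) k l \<le> e"
proof -
  obtain B where B: "0 < B" "(\<lambda>x. clamp_norm B (f x)) \<in> L2"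
    and fB: "(L2_norm (\<lambda>x. f x - clamp_norm B (f x)))\<^sup>2 < e / 4"
    using L2_approx_bounded[OF f, of "e / 4"] \<open>0 < e\<close> by auto
  obtain h where h: "continuous_on UNIV h" "\<And>x. norm (h x) \<le> B"
    and Bh: "(L2_norm (\<lambda>x. indicator (dyad k l) x * (clamp_norm B (f x) - h x)))\<^sup>2 < e / 4"
    using bounded_approx_continuous[OF L2_measurable[OF f] B(1), of "e / 4" k l] \<open>0 < e\<close> by auto
  let ?K = "dyad k l"
  \<comment> \<open>Cutting \<open>h\<close> off outside the interval puts it into \<open>L2\<close>
    and leaves its values on the interval untouched; uniform continuity comes from the compact
    closure.\<close>
  let ?g = "\<lambda>x. indicator ?K x * h x"
  have [measurable]: "h \<in> borel_measurable lebesgue"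
    using h(1) by (intro measurable_completion) (simp add: borel_measurable_continuous_onI)
  have g: "?g \<in> L2"
  proof (rule L2_bounded[OF _ indicator_dyad_L2[of k l], of _ B])
    show "?g \<in> borel_measurable lebesgue" using dyad_sets by measurable
    show "norm (?g x) \<le> B * norm (indicator ?K x :: complex)" for x
      using h(2)[of x] by (simp split: split_indicator)
  qed
  have "compact {2 powi k * real_of_int l .. 2 powi k * real_of_int (l + 1)}"
    by (rule compact_Icc)
  then have "uniformly_continuous_on {2 powi k * real_of_int l .. 2 powi k * real_of_int (l + 1)} h"
    by (intro compact_uniformly_continuous continuous_on_subset[OF h(1)]) auto
  moreover have "?K \<subseteq> {2 powi k * real_of_int l .. 2 powi k * real_of_int (l + 1)}"
    by (auto simp: dyad_def)
  ultimately have "uniformly_continuous_on ?K h"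
    unfolding uniformly_continuous_on_def by (meson subsetD)
  then have uc: "uniformly_continuous_on ?K ?g"
    by (simp add: uniformly_continuous_on_def)
  have u: "(\<lambda>x. indicator ?K x * (f x - clamp_norm B (f x))) \<in> L2"
    by (intro dyad_L2 L2_diff f B)
  have v: "(\<lambda>x. indicator ?K x * (clamp_norm B (f x) - h x)) \<in> L2"
    using L2_diff[OF dyad_L2[OF B(2), of k l] g] by (simp add: right_diff_distrib)
  have "indicator ?K x * (f x - ?g x) = indicator ?K x * (f x - clamp_norm B (f x))
      + indicator ?K x * (clamp_norm B (f x) - h x)" for x
    by (simp split: split_indicator)
  then have "dyad_energy (\<lambda>x. f x - ?g x) k l
      \<le> 2 * (L2_norm (\<lambda>x. indicator ?K x * (f x - clamp_norm B (f x))))\<^sup>2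
        + 2 * (L2_norm (\<lambda>x. indicator ?K x * (clamp_norm B (f x) - h x)))\<^sup>2"
    unfolding dyad_energy_def using L2_norm_add_sq_le[OF u v] by simp
  also have "(L2_norm (\<lambda>x. indicator ?K x * (f x - clamp_norm B (f x))))\<^sup>2
      \<le> (L2_norm (\<lambda>x. f x - clamp_norm B (f x)))\<^sup>2"
    unfolding L2_norm_sq
    by (intro integral_mono L2_integrable_sq u L2_diff f B) (simp split: split_indicator)
  finally have "dyad_energy (\<lambda>x. f x - ?g x) k l \<le> e"
    using fB Bh by simp
  with g uc show ?thesis by (rule that)
qed

text \<open>The lower half of Parseval's identity on one interval, up to \<open>e\<close>: a
  uniformly continuous approximation of \<open>f\<close> supplies the small oscillation at some
  finite depth.\<close>

theorem haar_complete:
  assumes f: "f \<in> L2" and "0 < e"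
  obtains F where "finite F" "F \<subseteq> dyadic_intervals" "\<forall>J\<in>F. J \<subseteq> dyad k l"
    "dyad_energy f k l - (norm (dyad_integral f k l))\<^sup>2 / 2 powi k \<le> (\<Sum>J\<in>F. (norm (haar_coeff f J))\<^sup>2) + e"
proof -
  obtain g where g: "g \<in> L2" "uniformly_continuous_on (dyad k l) g"
    and near: "dyad_energy (\<lambda>x. f x - g x) k l \<le> e / 4"
    using L2_approx_uniformly_continuous[OF f, of "e / 4"] \<open>0 < e\<close> by auto
  \<comment> \<open>Chosen so that the oscillation error is \<open>e / 2\<close>; twice the
    approximation error \<open>e / 4\<close> makes up the rest.\<close>
  define d where "d = sqrt (e / (4 * 2 powi k))"
  have d: "0 < d" "2 * d\<^sup>2 * 2 powi k = e / 2"
    using \<open>0 < e\<close> by (auto simp: d_def)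
  obtain r where "0 < r" and r: "\<And>x y. x \<in> dyad k l \<Longrightarrow> y \<in> dyad k l \<Longrightarrow> dist x y < r \<Longrightarrow> dist (g x) (g y) < d"
    using g(2) d(1) unfolding uniformly_continuous_on_def by metis
  have "0 < r / 2 powi k" using \<open>0 < r\<close> by simp
  then obtain n where n: "(1/2::real) ^ n < r / 2 powi k"
    using real_arch_pow_inv[of "r / 2 powi k" "1/2"] by auto
  then have n: "2 powi k / 2 ^ n < r"
    by (simp add: field_simps)
  have osc: "norm (g x - g y) \<le> d" if "x \<in> dyad k l" "y \<in> dyad k l" "\<bar>x - y\<bar> \<le> 2 powi k / 2 ^ n" for x y
    using r[OF that(1,2)] that(3) n by (simp add: dist_norm)
  have "\<exists>F. finite F \<and> F \<subseteq> dyadic_intervals \<and> (\<forall>J\<in>F. J \<subseteq> dyad k l) \<and>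
    dyad_energy f k l - (norm (dyad_integral f k l))\<^sup>2 / 2 powi k
      \<le> (\<Sum>J\<in>F. (norm (haar_coeff f J))\<^sup>2) + 2 * dyad_energy (\<lambda>x. f x - g x) k l + 2 * d\<^sup>2 * 2 powi k"
    by (rule haar_energy_approx[OF f g(1) less_imp_le[OF d(1)]]) (rule osc)
  then obtain F where F': "finite F" "F \<subseteq> dyadic_intervals" "\<forall>J\<in>F. J \<subseteq> dyad k l"
    and F: "dyad_energy f k l - (norm (dyad_integral f k l))\<^sup>2 / 2 powi k
      \<le> (\<Sum>J\<in>F. (norm (haar_coeff f J))\<^sup>2) + 2 * dyad_energy (\<lambda>x. f x - g x) k l + 2 * d\<^sup>2 * 2 powi k"
    by (elim exE conjE)
  from F near have "dyad_energy f k l - (norm (dyad_integral f k l))\<^sup>2 / 2 powi k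
      \<le> (\<Sum>J\<in>F. (norm (haar_coeff f J))\<^sup>2) + e"
    unfolding d(2) by linarith
  with F' show ?thesis by (rule that)
qed

subsection \<open>The lower bound for the Haar shift\<close>

lemma left_half_subset: "J \<in> dyadic_intervals \<Longrightarrow> left_half J \<subseteq> J"
  and right_half_subset: "J \<in> dyadic_intervals \<Longrightarrow> right_half J \<subseteq> J"
proof -
  have "dyad (k - 1) (2 * l) \<subseteq> dyad k l" "dyad (k - 1) (2 * l + 1) \<subseteq> dyad k l" for k l
    unfolding dyad_split[of k l] by (rule Un_upper1 Un_upper2)+
  then show "J \<in> dyadic_intervals \<Longrightarrow> left_half J \<subseteq> J" "J \<in> dyadic_intervals \<Longrightarrow> right_half J \<subseteq> J"
    by (elim dyadE, simp only: left_half_dyad right_half_dyad)+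
qed

lemma half_neq_of_subset:
  assumes "J \<in> dyadic_intervals" "J \<subseteq> dyad k l"
  shows "left_half J \<noteq> dyad k l" "right_half J \<noteq> dyad k l"
proof -
  obtain j m where [simp]: "J = dyad j m" using assms(1) by (rule dyadE)
  have "j \<le> k" using assms(2) by (simp add: dyad_subset_level)
  then show "left_half J \<noteq> dyad k l" "right_half J \<noteq> dyad k l"
    by (simp_all add: left_half_dyad right_half_dyad)
qed

lemma haar_coeff_restrict:
  assumes "J \<in> dyadic_intervals" "J \<subseteq> K"
  shows "haar_coeff (\<lambda>x. indicator K x * g x) J = haar_coeff g J"
proof -
  obtain j m where J: "J = dyad j m" using assms(1) by (rule dyadE)
  have "indicator K x * g x * complex_of_real (haar J x) = g x * complex_of_real (haar J x)" for x
    using haar_outside[of x j m] assms(2) unfolding J by (cases "x \<in> dyad j m") auto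
  then show ?thesis by (simp only: haar_coeff_def)
qed

text \<open>Since \<open>f\<close> vanishes almost everywhere on the sibling, the parent's
  coefficient is, up to sign, the integral of \<open>f\<close> divided by the root of the parent's
  length \<open>2 * 2 powi k\<close>.\<close>

lemma dyad_parent:
  assumes f: "f \<in> L2" "AE x in lebesgue. x \<notin> dyad k l \<longrightarrow> f x = 0"
  obtains P where "P \<in> dyadic_intervals" "left_half P = dyad k l \<or> right_half P = dyad k l"
    "(norm (haar_coeff f P))\<^sup>2 = (norm (dyad_integral f k l))\<^sup>2 / (2 * 2 powi k)"
proof -
  \<comment> \<open>Rounding down in \<open>l div 2\<close> covers both parities: the interval is
    the left half for even \<open>l\<close> and the right half for odd \<open>l\<close>.\<close>
  define P where "P = dyad (k + 1) (l div 2)"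
  have split: "2 * (l div 2) = l \<or> 2 * (l div 2) + 1 = l" by presburger
  have halves: "left_half P = dyad k (2 * (l div 2))" "right_half P = dyad k (2 * (l div 2) + 1)"
    by (simp_all add: P_def left_half_dyad right_half_dyad)
  have zero: "dyad_integral f k l' = 0"
    if "l' \<noteq> l" for l'
    unfolding dyad_integral_def
  proof (rule integral_eq_zero_AE)
    show "AE x in lebesgue. indicator (dyad k l') x * f x = 0"
      using f(2) by eventually_elim (use that dyad_disjoint in \<open>auto split: split_indicator\<close>)
  qed
  have pow: "(sqrt (2 powi (k + 1)))\<^sup>2 = 2 * 2 powi k"
    using powi_two_pred[of "k + 1"] by simp
  have "(norm (haar_coeff f P))\<^sup>2 = (norm (dyad_integral f k l))\<^sup>2 / (2 * 2 powi k)"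
  proof -
    have "haar_coeff f P = (dyad_integral f k (2 * (l div 2) + 1) - dyad_integral f k (2 * (l div 2)))
        / complex_of_real (sqrt (2 powi (k + 1)))"
      using haar_coeff_dyad[OF f(1), of "k + 1" "l div 2"] by (simp add: P_def)
    then have "(norm (haar_coeff f P))\<^sup>2
        = (norm (dyad_integral f k (2 * (l div 2) + 1) - dyad_integral f k (2 * (l div 2))))\<^sup>2 / (2 * 2 powi k)"
      by (simp only: norm_divide power_divide norm_of_real power2_abs pow)
    also have "norm (dyad_integral f k (2 * (l div 2) + 1) - dyad_integral f k (2 * (l div 2)))
        = norm (dyad_integral f k l)"
      using split
    proof
      assume l: "2 * (l div 2) = l"
      show ?thesis unfolding l using zero[of "l + 1"] by simp
    next
      assume l: "2 * (l div 2) + 1 = l"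
      have "2 * (l div 2) \<noteq> l" using l by linarith
      from zero[OF this] show ?thesis unfolding l by simp
    qed
    finally show ?thesis .
  qed
  moreover have "left_half P = dyad k l \<or> right_half P = dyad k l"
    using split unfolding halves dyad_inject by blast
  moreover have "P \<in> dyadic_intervals"
    by (simp add: P_def dyad_in_dyadic_intervals)
  ultimately show ?thesis by (intro that)
qed

lemma haar_coeff_haar_shift_norm:
  assumes "f \<in> L2" "J \<in> dyadic_intervals"
  shows "(norm (haar_coeff (haar_shift f) (left_half J)))\<^sup>2 = (norm (haar_coeff f J))\<^sup>2 / 2"
    and "(norm (haar_coeff (haar_shift f) (right_half J)))\<^sup>2 = (norm (haar_coeff f J))\<^sup>2 / 2"
  using assms by (simp_all add: haar_coeff_haar_shift norm_divide power_divide)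

text \<open>Besides the children of the intervals in \<open>F\<close>, Bessel's inequality picks up the Haar function
  of \<open>K\<close> itself, which enters \<open>S f\<close> through the parent of \<open>K\<close>.\<close>

lemma haar_shift_restrict_ge:
  assumes f: "f \<in> L2" and P: "P \<in> dyadic_intervals" "left_half P = dyad k l \<or> right_half P = dyad k l"
    and F: "finite F" "F \<subseteq> dyadic_intervals" "\<forall>J\<in>F. J \<subseteq> dyad k l"
  shows "(\<Sum>J\<in>F. (norm (haar_coeff f J))\<^sup>2) + (norm (haar_coeff f P))\<^sup>2 / 2
    \<le> (L2_norm (\<lambda>x. indicator (dyad k l) x * haar_shift f x))\<^sup>2"
proof -
  let ?K = "dyad k l"
  let ?g = "\<lambda>x. indicator ?K x * haar_shift f x"
  let ?A = "insert ?K (left_half ` F \<union> right_half ` F)"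
  let ?c = "\<lambda>J. (norm (haar_coeff (haar_shift f) J))\<^sup>2"
  have Sf: "haar_shift f \<in> L2"
    using is_haar_shift_haar_shift[OF f] by (simp add: is_haar_shift_def)
  have A: "?A \<subseteq> dyadic_intervals"
    using F(2) dyad_in_dyadic_intervals[of k l] dyadic_half by auto
  have sub: "J \<subseteq> ?K" if "J \<in> ?A" for J
  proof -
    have "left_half M \<subseteq> ?K" "right_half M \<subseteq> ?K" if "M \<in> F" for M
      using left_half_subset[OF subsetD[OF F(2) that]] right_half_subset[OF subsetD[OF F(2) that]]
        bspec[OF F(3) that] by (simp_all only: subset_trans)
    then show ?thesis using that by auto
  qed
  have "?c ?K = (norm (haar_coeff f P))\<^sup>2 / 2"
    using P haar_coeff_haar_shift_norm[OF f P(1)] by metis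
  moreover have "sum ?c ?A = ?c ?K + (sum ?c (left_half ` F) + sum ?c (right_half ` F))"
  proof -
    have "?K \<notin> left_half ` F \<union> right_half ` F"
    proof
      assume "?K \<in> left_half ` F \<union> right_half ` F"
      then obtain J where "J \<in> F" "left_half J = ?K \<or> right_half J = ?K" by auto
      then show False using half_neq_of_subset[of J k l] F(2,3) by blast
    qed
    moreover have "left_half ` F \<inter> right_half ` F = {}"
      using left_half_neq_right_half F(2) by blast
    ultimately show ?thesis
      using F(1) by (simp add: sum.union_disjoint)
  qed
  \<comment> \<open>Each \<open>J\<close> in \<open>F\<close> is met through both children, each
    time with half of its squared coefficient.\<close>
  moreover have "sum ?c (left_half ` F) = (\<Sum>J\<in>F. (norm (haar_coeff f J))\<^sup>2 / 2)"
    using F(2) by (subst sum.reindex[OF inj_on_subset[OF inj_on_left_half]])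
      (auto intro!: sum.cong simp: haar_coeff_haar_shift_norm[OF f] subset_iff)
  moreover have "sum ?c (right_half ` F) = (\<Sum>J\<in>F. (norm (haar_coeff f J))\<^sup>2 / 2)"
    using F(2) by (subst sum.reindex[OF inj_on_subset[OF inj_on_right_half]])
      (auto intro!: sum.cong simp: haar_coeff_haar_shift_norm[OF f] subset_iff)
  ultimately have "(\<Sum>J\<in>F. (norm (haar_coeff f J))\<^sup>2) + (norm (haar_coeff f P))\<^sup>2 / 2 = sum ?c ?A"
    by (simp add: sum_divide_distrib[symmetric])
  \<comment> \<open>Every interval of \<open>?A\<close> lies inside \<open>?K\<close>, so cutting
    the shift off to \<open>?K\<close> does not change these coefficients.\<close>
  also have "\<dots> = (\<Sum>J\<in>?A. (norm (L2_coeff ?g (haar J)))\<^sup>2)"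
    by (intro sum.cong refl) (simp only: haar_coeff_restrict[OF subsetD[OF A] sub] flip: haar_coeff_eq)
  also have "\<dots> \<le> (L2_norm ?g)\<^sup>2"
    using F(1) A by (intro bessel_finite[OF haar_orthonormal] dyad_L2 Sf) auto
  finally show ?thesis .
qed

theorem theorem3p1:
  fixes I K :: "real set" and f :: "real \<Rightarrow> complex"
  assumes "I \<in> dyadic_intervals" and "K \<in> dyadic_intervals" and "I \<subseteq> K"
    and "f \<in> L2"
    and "AE x in lebesgue. x \<notin> I \<longrightarrow> f x = 0"
  shows "(L2_norm (\<lambda>x. indicator K x * haar_shift f x))\<^sup>2
           \<ge> (1 - 3 / 4 * (measure lebesgue I / measure lebesgue K)) * (L2_norm f)\<^sup>2"
proof -
  note f = \<open>f \<in> L2\<close>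
  obtain j i where I: "I = dyad j i" using assms(1) by (rule dyadE)
  obtain k l where K: "K = dyad k l" using assms(2) by (rule dyadE)
  have AE_K: "AE x in lebesgue. x \<notin> dyad k l \<longrightarrow> f x = 0"
    using assms(5)
  proof eventually_elim
    case (elim x)
    then show ?case using subsetD[OF assms(3), of x] unfolding K by argo
  qed
  have energy: "dyad_energy f k' l' = (L2_norm f)\<^sup>2"
    if "AE x in lebesgue. x \<notin> dyad k' l' \<longrightarrow> f x = 0" for k' l'
    unfolding dyad_energy_def L2_norm_sq
  proof (rule integral_cong_AE)
    show "AE x in lebesgue. (norm (indicator (dyad k' l') x * f x))\<^sup>2 = (norm (f x))\<^sup>2"
      using that by eventually_elim (simp split: split_indicator)
  qed (intro borel_measurable_integrable L2_integrable_sq dyad_L2 f)+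
  define m where "m = dyad_integral f k l"
  have "m = dyad_integral f j i"
    unfolding m_def dyad_integral_def
  proof (rule integral_cong_AE)
    show "AE x in lebesgue. indicator (dyad k l) x * f x = indicator (dyad j i) x * f x"
      using assms(5)
    proof eventually_elim
      case (elim x)
      then show ?case
        using subsetD[OF assms(3), of x] unfolding I K by (auto split: split_indicator)
    qed
  qed (intro L2_measurable dyad_L2 f)+
  \<comment> \<open>Cauchy--Schwarz is applied on the small interval \<open>I\<close>, where all of
    \<open>f\<close> lives; this is the source of the factor \<open>|I|\<close>.\<close>
  then have m: "(norm m)\<^sup>2 \<le> 2 powi j * (L2_norm f)\<^sup>2"
    using dyad_mean_sq_le[OF f, of j i] energy[of j i] assms(5) by (simp add: I pos_divide_le_eq mult.commute)
  obtain P where P: "P \<in> dyadic_intervals" "left_half P = dyad k l \<or> right_half P = dyad k l"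
    and "(norm (haar_coeff f P))\<^sup>2 = (norm m)\<^sup>2 / (2 * 2 powi k)"
    unfolding m_def by (rule dyad_parent[OF f AE_K])
  then have cP: "(norm (haar_coeff f P))\<^sup>2 / 2 = 1 / 4 * ((norm m)\<^sup>2 / 2 powi k)"
    by simp
  \<comment> \<open>Completeness loses the mean term once and the parent of \<open>K\<close> returns
    a quarter of it, which leaves 3/4. Completeness holds only up to \<open>e\<close>, so
    \<open>e\<close> is sent to zero.\<close>
  have "(L2_norm f)\<^sup>2 - 3 / 4 * ((norm m)\<^sup>2 / 2 powi k)
      \<le> (L2_norm (\<lambda>x. indicator K x * haar_shift f x))\<^sup>2"
  proof (rule field_le_epsilon)
    fix e :: real assume "0 < e"
    obtain F where F: "finite F" "F \<subseteq> dyadic_intervals" "\<forall>J\<in>F. J \<subseteq> dyad k l"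
      and "dyad_energy f k l - (norm (dyad_integral f k l))\<^sup>2 / 2 powi k \<le> (\<Sum>J\<in>F. (norm (haar_coeff f J))\<^sup>2) + e"
      by (rule haar_complete[OF f \<open>0 < e\<close>, of k l])
    then have "(L2_norm f)\<^sup>2 - (norm m)\<^sup>2 / 2 powi k \<le> (\<Sum>J\<in>F. (norm (haar_coeff f J))\<^sup>2) + e"
      using energy[OF AE_K] by (simp add: m_def)
    then show "(L2_norm f)\<^sup>2 - 3 / 4 * ((norm m)\<^sup>2 / 2 powi k)
      \<le> (L2_norm (\<lambda>x. indicator K x * haar_shift f x))\<^sup>2 + e"
      using haar_shift_restrict_ge[OF f P F] cP unfolding K by linarith
  qed
  moreover have "(norm m)\<^sup>2 / 2 powi k \<le> 2 powi j / 2 powi k * (L2_norm f)\<^sup>2"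
    using divide_right_mono[OF m, of "2 powi k"] by simp
  ultimately show ?thesis
    unfolding I K measure_dyad left_diff_distrib mult_1_left mult.assoc by linarith
qed

end
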